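(* Let $(X,d,\mu)$ be a complete, connected metric measure space equipped with a doubling measure. Let $0<s<1$ and let $Q$ be a doubling dimension such that $Q>s$. Let $\Omega\subset X$ be a nonempty open set and let $u$ be an $s$-subminimizer in $\Omega$. Then there exists a constant $C>0$ depending only on $s$ and the doubling constant $C_\mu$ such that for every $k_0\in\mathbb R$, every $x_0\in\Omega$, and all $0<r<R$ with $B(x_0,R)\subset\Omega$, $$\operatorname*{ess\,sup}_{y\in B(x_0,r)}(u(y)-k_0)\le C\left(\frac{R}{R-r}\right)^Q \frac{1}{\mu(B(x_0,R))}\int_{B(x_0,R)}(u-k_0)_+\,d\mu .$$
   Context: A metric measure space $(X,d,\mu)$ is a nonempty separable metric space $(X,d)$ with a locally finite Borel-regular outer measure $\mu$ on $X$. $B(x,r)$ is the open ball with center $x$ and radius $r>0$. It is equipped with a doubling measure if there is a doubling constant $C_\mu>0$ such that $0<\mu(B(x,r))<\infty$ and $\mu(B(x,2r))\le C_\mu\mu(B(x,r))$ for all balls $B(x,r)$. A number $Q>0$ is a doubling dimension if there is a constant $c>0$ such that $\mu(B(x,r))/\mu(B(x,R))\ge c\,(r/R)^Q$ for all $0<r<R$ and $x\in X$. Write $B_{x,y}:=B(x,d(x,y))\cup B(y,d(x,y))$, $\Omega^c:=X\setminus\Omega$ and $a_+:=\max\{a,0\}$. For an open set $\Omega\subset X$ and measurable $u:\Omega\to[-\infty,\infty]$ let $$\|u\|_{\dot W^{s,1}(\Omega)}:=\int_\Omega\int_\Omega\frac{|u(x)-u(y)|}{\mu(B_{x,y})d(x,y)^s}\,d\mu(x)\,d\mu(y),\qquad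 \|u\|_{W^{s,1}(\Omega)}:=\|u\|_{L^1(\Omega)}+\|u\|_{\dot W^{s,1}(\Omega)};$$ $\dot W^{s,1}(\Omega)$ and $W^{s,1}(\Omega)$ are the spaces of measurable functions on $\Omega$ for which the respective quantity is finite. $W^{s,1}_0(\Omega)$ is the set of $u\in W^{s,1}(X)$ with $u=0$ a.e. on $\Omega^c$. For measurable functions $u,v$ on $X$ let $$F(u,v):=\left(\int_\Omega\int_\Omega+2\int_\Omega\int_{\Omega^c}\right)\frac{|u(x)-u(y)|-|v(x)-v(y)|}{\mu(B_{x,y})d(x,y)^s}\,d\mu(x)\,d\mu(y).$$ A measurable function $u:X\to[-\infty,\infty]$ is an $s$-subminimizer (resp. $s$-superminimizer) in $\Omega$ if $u\in\dot W^{s,1}(\Omega)$ and $F(u,u+\eta)\le 0$ for every nonpositive (resp. nonnegative) $\eta\in W^{s,1}_0(\Omega)$.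
   Formalization: C depends on s, C_μ and also on the constant c in the definition of the doubling dimension Q (independence of c fails for general Q); C is uniform over spaces with points in one fixed set, and a set of continuum size covers all separable spaces. *)

theory Defs
  imports "HOL-Probability.Essential_Supremum"
begin

text \<open>
  The space is a carrier \<open>X\<close> with a distance function \<open>d\<close>, rather than a type of class
  \<open>metric_space\<close>: a constant that must not depend on the space can then be quantified before it.
  The measure is an outer measure \<open>mu\<close> on all subsets of \<open>X\<close>. Functions on \<open>X\<close> (or on an open
  subset of it) are total functions whose values outside \<open>X\<close> (outside the subset) are irrelevant.
\<close>

locale metric_measure_space = Metric_space X d
  for X :: "'a set" and d :: "'a \<Rightarrow> 'a \<Rightarrow> real" +
  fixes mu :: "'a set \<Rightarrow> ennreal"
  assumes nonempty: "X \<noteq> {}"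
    and separable: "separable_space mtopology"
    and outer_measure: "outer_measure_space (Pow X) mu"
    and borel_measurable_sets:
      "sigma_sets X {U. openin mtopology U} \<subseteq> lambda_system X (Pow X) mu"
    and borel_regular:
      "\<And>A. A \<subseteq> X \<Longrightarrow> \<exists>B \<in> sigma_sets X {U. openin mtopology U}. A \<subseteq> B \<and> mu B = mu A"
    and locally_finite: "\<And>x. x \<in> X \<Longrightarrow> \<exists>r>0. mu (mball x r) < \<infinity>"
begin

text \<open>Measurability is with respect to the Caratheodory-measurable sets of \<open>mu\<close>.\<close>

definition M :: "'a measure" where
  "M = measure_of X (lambda_system X (Pow X) mu) mu"

definition doubling_measure :: "real \<Rightarrow> bool" where
  "doubling_measure Cmu \<longleftrightarrow> 0 < Cmu \<and>
     (\<forall>x\<in>X. \<forall>r>0. 0 < mu (mball x r) \<and> mu (mball x r) < \<infinity> \<and>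
        mu (mball x (2 * r)) \<le> ennreal Cmu * mu (mball x r))"

text \<open>\<open>Q\<close> is a doubling dimension iff \<open>\<exists>c. doubling_dimension c Q\<close>.\<close>

definition doubling_dimension :: "real \<Rightarrow> real \<Rightarrow> bool" where
  "doubling_dimension c Q \<longleftrightarrow> 0 < c \<and> 0 < Q \<and>
     (\<forall>x\<in>X. \<forall>r R. 0 < r \<and> r < R \<longrightarrow>
        mu (mball x r) / mu (mball x R) \<ge> ennreal (c * (r / R) powr Q))"

definition kernel_denom :: "real \<Rightarrow> 'a \<Rightarrow> 'a \<Rightarrow> ennreal" where
  "kernel_denom s x y = mu (mball x (d x y) \<union> mball y (d x y)) * ennreal (d x y powr s)"

text \<open>
  In \<open>ereal\<close>, both \<open>\<infinity> - \<infinity>\<close> and \<open>-\<infinity> - (-\<infinity>)\<close> equal \<open>\<infinity>\<close>. Hence \<open>\<bar>u x - u y\<bar> = \<infinity>\<close> as soon as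
  \<open>u x\<close> or \<open>u y\<close> is infinite.
\<close>

definition W_seminorm :: "real \<Rightarrow> 'a set \<Rightarrow> ('a \<Rightarrow> ereal) \<Rightarrow> ennreal" where
  "W_seminorm s \<Omega> u =
     (\<integral>\<^sup>+y\<in>\<Omega>. (\<integral>\<^sup>+x\<in>\<Omega>. (e2ennreal \<bar>u x - u y\<bar> / kernel_denom s x y) \<partial>M) \<partial>M)"

definition W_norm :: "real \<Rightarrow> 'a set \<Rightarrow> ('a \<Rightarrow> ereal) \<Rightarrow> ennreal" where
  "W_norm s \<Omega> u = (\<integral>\<^sup>+x\<in>\<Omega>. e2ennreal \<bar>u x\<bar> \<partial>M) + W_seminorm s \<Omega> u"

definition W_dot :: "real \<Rightarrow> 'a set \<Rightarrow> ('a \<Rightarrow> ereal) set" where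
  "W_dot s \<Omega> = {u \<in> borel_measurable (restrict_space M \<Omega>). W_seminorm s \<Omega> u < \<infinity>}"

definition W :: "real \<Rightarrow> 'a set \<Rightarrow> ('a \<Rightarrow> ereal) set" where
  "W s \<Omega> = {u \<in> borel_measurable (restrict_space M \<Omega>). W_norm s \<Omega> u < \<infinity>}"

definition W0 :: "real \<Rightarrow> 'a set \<Rightarrow> ('a \<Rightarrow> ereal) set" where
  "W0 s \<Omega> = {u \<in> W s X. AE x in M. x \<in> X - \<Omega> \<longrightarrow> u x = 0}"

text \<open>
  The Lebesgue integral of a signed extended-real function over \<open>A\<close>: integral of the positive part
  minus integral of the negative part (\<open>e2ennreal\<close> maps negative arguments to \<open>0\<close>). It takes the
  value \<open>\<infinity>\<close>, not a default real number, if both parts have infinite integral.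
\<close>

definition signed_integral :: "'a set \<Rightarrow> ('a \<Rightarrow> ereal) \<Rightarrow> ereal" where
  "signed_integral A f =
     enn2ereal (\<integral>\<^sup>+x\<in>A. e2ennreal (f x) \<partial>M) - enn2ereal (\<integral>\<^sup>+x\<in>A. e2ennreal (- f x) \<partial>M)"

definition F :: "real \<Rightarrow> 'a set \<Rightarrow> ('a \<Rightarrow> ereal) \<Rightarrow> ('a \<Rightarrow> ereal) \<Rightarrow> ereal" where
  "F s \<Omega> u v =
     (let f = (\<lambda>x y. (\<bar>u x - u y\<bar> - \<bar>v x - v y\<bar>) / enn2ereal (kernel_denom s x y)) in
        signed_integral \<Omega> (\<lambda>y. signed_integral \<Omega> (\<lambda>x. f x y))
        + 2 * signed_integral \<Omega> (\<lambda>y. signed_integral (X - \<Omega>) (\<lambda>x. f x y)))"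

definition subminimizer :: "real \<Rightarrow> 'a set \<Rightarrow> ('a \<Rightarrow> ereal) \<Rightarrow> bool" where
  "subminimizer s \<Omega> u \<longleftrightarrow>
     u \<in> borel_measurable M \<and> u \<in> W_dot s \<Omega> \<and>
     (\<forall>\<eta> \<in> W0 s \<Omega>. (\<forall>x\<in>X. \<eta> x \<le> 0) \<longrightarrow> F s \<Omega> u (\<lambda>x. u x + \<eta> x) \<le> 0)"

definition ess_sup_on :: "'a set \<Rightarrow> ('a \<Rightarrow> ereal) \<Rightarrow> ereal" where
  "ess_sup_on A f = esssup (restrict_space M A) f"

definition average :: "'a set \<Rightarrow> ('a \<Rightarrow> ereal) \<Rightarrow> ereal" where
  "average A f = signed_integral A f / enn2ereal (mu A)"

end

end

theory Submission
  imports Defs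
begin

text \<open>
  Let \<open>w = (u - k)\<^sub>+\<close> and let \<open>\<phi>\<close> be a Lipschitz cutoff. Testing with \<open>- \<phi> w\<close> changes only the
  truncation \<open>w\<close> in the functional, and since the functional has linear growth, each pair \<open>(x, y)\<close>
  costs at most \<open>min (w x) (w y) * \<bar>\<phi> x - \<phi> y\<bar>\<close>, so that no nonlocal tail of \<open>u\<close> arises. Pairs
  with \<open>w x = 0 < w y\<close> contribute \<open>\<phi> y * w y\<close>. If \<open>{w > 0}\<close> fills at most half of every ball of
  radius \<open>r\<close>, the kernel integrates to at least \<open>c r powr (- s)\<close> over the complement of
  \<open>{w > 0}\<close>, while it integrates to at most \<open>C \<delta> powr (- s)\<close> against a cutoff of width \<open>\<delta>\<close>. Hence
  the integral of \<open>w\<close> over a ball is at most \<open>C (r / \<delta>) powr s\<close> times that over the ball enlarged by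
  \<open>\<delta>\<close>, without any Sobolev inequality. De Giorgi's iteration over shrinking balls and increasing
  levels, with \<open>r / \<delta>\<close> fixed and small, bounds \<open>u\<close> on half of a ball by a constant depending on
  \<open>s\<close> and the doubling constant alone. Covering \<open>B(x\<^sub>0, r)\<close> by such balls of radius \<open>R - r\<close> brings in
  the doubling dimension, and only there.
\<close>

section \<open>Dyadic scales, extended-real subtraction and pointwise cutoff inequalities\<close>

lemma dyadic_bracket:
  fixes t :: real
  assumes "1 \<le> t"
  obtains n where "2 ^ n \<le> t" "t \<le> 2 ^ Suc n"
proof -
  obtain m where m: "t < 2 ^ m" using real_arch_pow[of 2 t] by auto
  define n where "n = (LEAST n. t < 2 ^ Suc n)"
  have "(2::real) ^ m \<le> 2 ^ Suc m" by (intro power_increasing) auto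
  with m have "t < 2 ^ Suc m" by (rule less_le_trans)
  then have 1: "t < 2 ^ Suc n" unfolding n_def by (rule LeastI)
  have "2 ^ n \<le> t"
  proof (cases n)
    case (Suc k)
    then have "\<not> t < 2 ^ Suc k" using not_less_Least[of k "\<lambda>n. t < 2 ^ Suc n"] n_def by auto
    then show ?thesis using Suc by simp
  qed (use assms in auto)
  with 1 show ?thesis by (intro that) auto
qed

lemma le_suminf_ennreal: "f n \<le> (\<Sum>n. f n :: ennreal)"
  using sum_le_suminf[of f "{n}"] by simp

text \<open>Two geometric series times the square of the doubling constant \<open>K\<close>: ratio
  \<open>2 powr (s - 1)\<close> for the annuli inside a cutoff width, ratio
  \<open>2 powr (- s)\<close> for those outside it.\<close>

definition kernel_const :: "real \<Rightarrow> real \<Rightarrow> real" where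
  "kernel_const s K = K\<^sup>2 * (2 powr s / (1 - 2 powr (s - 1)) + 1 / (1 - 2 powr (- s)))"

text \<open>Links the truncated subtraction of \<open>ennreal\<close> to the positive and negative
  parts that \<open>signed_integral\<close> integrates. Infinite \<open>b\<close> must be excluded:
  for \<open>a = b = top\<close> the negative part is \<open>0\<close>, but
  \<open>b - a = top\<close>.\<close>

lemma e2ennreal_diff_enn2ereal:
  assumes "b \<noteq> top"
  shows "e2ennreal (enn2ereal a - enn2ereal b) = a - b"
    and "e2ennreal (- (enn2ereal a - enn2ereal b)) = b - a"
proof -
  obtain r where r: "b = ennreal r" "0 \<le> r" using assms by (cases b) auto
  have "e2ennreal (enn2ereal a - enn2ereal b) = a - b \<and> e2ennreal (- (enn2ereal a - enn2ereal b)) = b - a"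
  proof (cases a)
    case (real t)
    then show ?thesis using r by (simp add: ennreal_minus e2ennreal_ereal)
  next
    case top
    then show ?thesis using r by (simp add: enn2ereal_top e2ennreal_infty e2ennreal_neg)
  qed
  then show "e2ennreal (enn2ereal a - enn2ereal b) = a - b"
    and "e2ennreal (- (enn2ereal a - enn2ereal b)) = b - a" by auto
qed

text \<open>The right side is symmetric in \<open>a\<close> and \<open>b\<close>, so
  \<open>(a - b) + b = (b - a) + a\<close> holds even at infinite values.\<close>

lemma ennreal_diff_add_eq_max: "(a - b) + b = max a (b :: ennreal)"
  using diff_eq_0_ennreal[of a b]
  by (cases "b \<le> a"; cases "b = top") (auto simp: max_def diff_add_cancel_ennreal less_top)

text \<open>In the application \<open>p\<close>, \<open>n\<close> are the integrals of the two terms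
  of a minorant, \<open>a'\<close>, \<open>b'\<close> those of their truncated differences, and
  \<open>a\<close>, \<open>b\<close> those of the two parts of the larger function. The balance
  \<open>eq\<close> avoids subtraction because \<open>p\<close> and \<open>a'\<close> may be
  infinite.\<close>

lemma enn2ereal_diff_mono:
  assumes eq: "a' + n = p + b'" and le: "a' \<le> a" "b \<le> b'" and fin: "n \<noteq> top" "b' \<noteq> top"
  shows "enn2ereal p - enn2ereal n \<le> enn2ereal a - enn2ereal b"
proof -
  obtain r t where rt: "n = ennreal r" "0 \<le> r" "b' = ennreal t" "0 \<le> t"
    using fin by (cases n; cases b') auto
  have "enn2ereal p - enn2ereal n = enn2ereal a' - enn2ereal b'"
  proof (cases a')
    case (real v)
    then have "p \<noteq> top" using eq rt by auto
    then obtain w where w: "p = ennreal w" "0 \<le> w" by (cases p) auto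
    then have "ennreal (v + r) = ennreal (w + t)" using eq rt real by simp
    then have "v + r = w + t" using rt real w by (subst (asm) ennreal_inj) auto
    then show ?thesis using rt real w by simp
  next
    case top
    then have "p = top" using eq rt by (cases p) (auto simp: ennreal_plus[symmetric] simp del: ennreal_plus)
    then show ?thesis using rt top by simp
  qed
  also have "\<dots> \<le> enn2ereal a - enn2ereal b"
    using le by (intro ereal_minus_mono) (auto simp: less_eq_ennreal.rep_eq)
  finally show ?thesis .
qed

text \<open>\<open>\<bar>a - b\<bar>\<close> is the sum of the contributions from below and from
  above the level \<open>k\<close>. Subtracting \<open>p * v\<close> with \<open>p \<le> 1\<close>
  never crosses \<open>k\<close>, so the part below is unchanged and cancels.\<close>

lemma abs_diff_truncation:
  fixes a b k p q :: real
  assumes "0 \<le> p" "p \<le> 1" "0 \<le> q" "q \<le> 1"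
  defines "v \<equiv> max (a - k) 0" and "w \<equiv> max (b - k) 0"
  shows "\<bar>a - b\<bar> - \<bar>(a - p * v) - (b - q * w)\<bar> = \<bar>v - w\<bar> - \<bar>(1 - p) * v - (1 - q) * w\<bar>"
proof -
  have *: "0 \<le> (1 - p) * v" "0 \<le> (1 - q) * w" using assms by (auto simp: v_def w_def)
  have e: "(1 - p) * v = v - p * v" "(1 - q) * w = w - q * w" by (auto simp: algebra_simps)
  consider "a \<ge> k" "b \<ge> k" | "a \<ge> k" "b < k" | "a < k" "b \<ge> k" | "a < k" "b < k" by linarith
  then show ?thesis
  proof cases
    case 1 then show ?thesis by (simp add: v_def w_def algebra_simps)
  next
    case 2
    then have "v = a - k" "w = 0" by (auto simp: v_def w_def)
    then show ?thesis using 2 * e by auto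
  next
    case 3
    then have "v = 0" "w = b - k" by (auto simp: v_def w_def)
    then show ?thesis using 3 * e by auto
  next
    case 4 then show ?thesis by (simp add: v_def w_def)
  qed
qed

text \<open>The change of the cutoff is multiplied by the value at only one of the two points.
  Exchanging the points puts the other value there, so the error can be charged to either.\<close>

lemma abs_diff_cutoff_le:
  fixes a b p q :: real
  assumes "0 \<le> p" "p \<le> 1" "0 \<le> b"
  shows "\<bar>(1 - p) * a - (1 - q) * b\<bar> \<le> \<bar>a - b\<bar> + \<bar>p - q\<bar> * b"
    and "\<bar>p * a - q * b\<bar> \<le> \<bar>a - b\<bar> + \<bar>p - q\<bar> * b"
proof -
  have "(1 - p) * a - (1 - q) * b = (1 - p) * (a - b) - (p - q) * b" by (simp add: algebra_simps)
  then have "\<bar>(1 - p) * a - (1 - q) * b\<bar> \<le> \<bar>(1 - p) * (a - b)\<bar> + \<bar>(p - q) * b\<bar>"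
    by (simp add: abs_triangle_ineq4)
  also have "\<dots> \<le> \<bar>a - b\<bar> + \<bar>p - q\<bar> * b"
    using assms by (auto simp: abs_mult intro!: mult_left_le_one_le)
  finally show "\<bar>(1 - p) * a - (1 - q) * b\<bar> \<le> \<bar>a - b\<bar> + \<bar>p - q\<bar> * b" .
  have "p * a - q * b = p * (a - b) + (p - q) * b" by (simp add: algebra_simps)
  then have "\<bar>p * a - q * b\<bar> \<le> \<bar>p * (a - b)\<bar> + \<bar>(p - q) * b\<bar>"
    by (simp add: abs_triangle_ineq)
  also have "\<dots> \<le> \<bar>a - b\<bar> + \<bar>p - q\<bar> * b"
    using assms by (auto simp: abs_mult intro!: mult_left_le_one_le)
  finally show "\<bar>p * a - q * b\<bar> \<le> \<bar>a - b\<bar> + \<bar>p - q\<bar> * b" .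
qed

text \<open>\<open>i\<close> and \<open>j\<close> stand for the indicators of the support at the two
  points. For \<open>a = 0\<close> the right side is exactly \<open>q * b\<close>. Otherwise the
  loss is charged to a point inside the support; if both lie outside, \<open>p = q = 0\<close> and
  nothing is lost.\<close>

lemma abs_diff_cutoff_ge:
  fixes a b p q i j :: real
  assumes "0 \<le> p" "p \<le> 1" "0 \<le> q" "q \<le> 1" "0 \<le> a" "0 \<le> b"
    and "i = 1 \<or> i = 0 \<and> p = 0" "j = 1 \<or> j = 0 \<and> q = 0"
  shows "(if a = 0 then q * b else 0) - \<bar>p - q\<bar> * (b * j + a * i)
    \<le> \<bar>a - b\<bar> - \<bar>(1 - p) * a - (1 - q) * b\<bar>"
proof (cases "a = 0")
  case True
  have "\<bar>(1 - q) * b\<bar> = (1 - q) * b" using assms by simp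
  with True show ?thesis using assms by (auto simp: algebra_simps)
next
  case False
  have "\<bar>(1 - p) * a - (1 - q) * b\<bar> \<le> \<bar>a - b\<bar> + \<bar>p - q\<bar> * b"
    using assms by (intro abs_diff_cutoff_le)
  moreover have "\<bar>(1 - p) * a - (1 - q) * b\<bar> \<le> \<bar>a - b\<bar> + \<bar>p - q\<bar> * a"
    using abs_diff_cutoff_le(1)[of q a b p] assms by (simp add: abs_minus_commute)
  moreover have "0 \<le> \<bar>p - q\<bar> * a" "0 \<le> \<bar>p - q\<bar> * b" using assms by auto
  ultimately show ?thesis using False assms(7,8) by (auto simp: distrib_left)
qed

text \<open>Meant for the seminorm of a cut-off truncation: \<open>i\<close>, \<open>j\<close> are
  indicators of the support, \<open>I\<close>, \<open>J\<close> those of a larger set, and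
  \<open>D\<close> bounds the oscillation. With one point outside the support its term vanishes and
  the change of the cutoff pays alone, so \<open>D\<close> is needed only for pairs inside.\<close>

lemma abs_cutoff_diff_le:
  fixes a b p q i j I J D :: real
  assumes pq: "0 \<le> p" "p \<le> 1" "0 \<le> q" "q \<le> 1" and ab: "0 \<le> a" "0 \<le> b" and D: "\<bar>a - b\<bar> \<le> D"
    and i: "i = 1 \<or> i = 0 \<and> p = 0" and j: "j = 1 \<or> j = 0 \<and> q = 0"
    and I: "I = 1 \<or> I = 0 \<and> i = 0" and J: "J = 1 \<or> J = 0 \<and> j = 0"
  shows "\<bar>p * a - q * b\<bar> \<le> D * I * J + \<bar>p - q\<bar> * (b * j + a * i)"
proof -
  have 1: "\<bar>p * a - q * b\<bar> \<le> \<bar>a - b\<bar> + \<bar>p - q\<bar> * b"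
    using pq ab by (intro abs_diff_cutoff_le)
  have 2: "\<bar>p * a - q * b\<bar> \<le> \<bar>a - b\<bar> + \<bar>p - q\<bar> * a"
    using abs_diff_cutoff_le(2)[of q a b p] pq ab by (simp add: abs_minus_commute)
  have 3: "0 \<le> \<bar>p - q\<bar> * a" "0 \<le> \<bar>p - q\<bar> * b" "0 \<le> q * b" "0 \<le> p * a" using pq ab by auto
  consider "i = 0" "p = 0" "j = 0" "q = 0" | "i = 0" "p = 0" "j = 1" | "i = 1" "j = 0" "q = 0" | "i = 1" "j = 1"
    using i j by auto
  then show ?thesis
  proof cases
    case 1
    have "0 \<le> D * I * J" using I J D by auto
    with 1 show ?thesis by simp
  next
    case 2
    have "0 \<le> D * I * J" using I J D by auto
    with 2 show ?thesis using pq 3 by simp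
  next
    case 3
    have "0 \<le> D * I * J" using I J D by auto
    with 3 show ?thesis using pq \<open>0 \<le> p * a\<close> by simp
  next
    case 4
    then have "I = 1" "J = 1" using I J by auto
    then show ?thesis using 4 1 D 3 by (simp add: distrib_left)
  qed
qed

section \<open>Measurability and lower bounds for signed integrals\<close>

context metric_measure_space
begin

lemma measure_space_lambda: "measure_space X (lambda_system X (Pow X) mu) mu"
  using sigma_algebra.caratheodory_lemma[OF sigma_algebra_Pow outer_measure] .

lemma sets_M: "sets M = lambda_system X (Pow X) mu"
proof -
  interpret sigma_algebra X "lambda_system X (Pow X) mu"
    using measure_space_lambda by (simp add: measure_space_def)
  show ?thesis
    unfolding M_def by (simp add: sets_measure_of_eq)
qed

lemma space_M [simp]: "space M = X"
  unfolding M_def by (rule space_measure_of) (auto simp: lambda_system_def)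

lemma emeasure_M: "A \<in> sets M \<Longrightarrow> emeasure M A = mu A"
  using emeasure_measure_of_sigma[of X "lambda_system X (Pow X) mu" mu A] measure_space_lambda
  by (simp add: sets_M measure_space_def M_def[symmetric])

lemma openin_sets_M: "openin mtopology U \<Longrightarrow> U \<in> sets M"
  using borel_measurable_sets by (auto simp: sets_M)

lemma mball_sets [measurable, simp]: "mball x r \<in> sets M"
  by (simp add: openin_sets_M)

lemma countable_dense:
  obtains D where "countable D" "D \<subseteq> X" "\<And>x e. x \<in> X \<Longrightarrow> 0 < e \<Longrightarrow> \<exists>q\<in>D. d x q < e"
proof -
  obtain D where D: "countable D" "D \<subseteq> X" "mtopology closure_of D = X"
    using separable unfolding separable_space_def by auto
  have "\<exists>q\<in>D. d x q < e" if "x \<in> X" "0 < e" for x e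
  proof -
    have "x \<in> mtopology closure_of D" using D that by simp
    then show ?thesis
      unfolding metric_closure_of using that by (auto simp: in_mball)
  qed
  then show ?thesis using that D by blast
qed

text \<open>The product sigma-algebra is generated by rectangles, so openness of the sublevel set
  does not by itself suffice. Separability turns the set into a countable union, over intermediate
  points \<open>q\<close>, of sets described by the distances to \<open>q\<close>.\<close>

lemma measurable_dist [measurable]:
  "(\<lambda>p. d (fst p) (snd p)) \<in> borel_measurable (M \<Otimes>\<^sub>M M)"
proof (rule borel_measurableI_less)
  fix a :: real
  obtain D where D: "countable D" "D \<subseteq> X" "\<And>x e. x \<in> X \<Longrightarrow> 0 < e \<Longrightarrow> \<exists>q\<in>D. d x q < e"
    by (rule countable_dense) blast
  have [measurable]: "(\<lambda>x. d x q) \<in> borel_measurable M" "(\<lambda>x. d q x) \<in> borel_measurable M"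
    if "q \<in> D" for q
  proof -
    have "{x \<in> space M. d x q < b} = mball q b" for b
      using D that by (auto simp: commute)
    then show "(\<lambda>x. d x q) \<in> borel_measurable M"
      by (intro borel_measurableI_less) simp
    then show "(\<lambda>x. d q x) \<in> borel_measurable M"
      by (simp add: commute)
  qed
  have "{p \<in> space (M \<Otimes>\<^sub>M M). d (fst p) (snd p) < a}
      = (\<Union>q\<in>D. {p \<in> space (M \<Otimes>\<^sub>M M). d (fst p) q + d q (snd p) < a})" (is "?L = ?R")
  proof
    show "?L \<subseteq> ?R"
    proof
      fix p assume p: "p \<in> ?L"
      then have X: "fst p \<in> X" "snd p \<in> X" by (auto simp: space_pair_measure)
      obtain q where q: "q \<in> D" "d (fst p) q < (a - d (fst p) (snd p)) / 2"
        using D(3)[of "fst p" "(a - d (fst p) (snd p)) / 2"] X p by auto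
      then have "d q (snd p) \<le> d q (fst p) + d (fst p) (snd p)"
        using X D by (intro triangle) auto
      with q have "d (fst p) q + d q (snd p) < a"
        by (simp add: commute field_simps)
      with q p show "p \<in> ?R" by auto
    qed
    show "?R \<subseteq> ?L"
    proof
      fix p assume "p \<in> ?R"
      then obtain q where q: "q \<in> D" "p \<in> space (M \<Otimes>\<^sub>M M)" "d (fst p) q + d q (snd p) < a"
        by auto
      moreover have "d (fst p) (snd p) \<le> d (fst p) q + d q (snd p)"
        using q D by (intro triangle) (auto simp: space_pair_measure)
      ultimately show "p \<in> ?L" by auto
    qed
  qed
  also have "\<dots> \<in> sets (M \<Otimes>\<^sub>M M)"
    using D(1) by (intro sets.countable_UN'') auto
  finally show "{p \<in> space (M \<Otimes>\<^sub>M M). d (fst p) (snd p) < a} \<in> sets (M \<Otimes>\<^sub>M M)" .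
qed

text \<open>Only monotonicity is applied to \<open>f\<close>; additivity is used on the measurable
  minorant alone. Hence the bound can be nested: \<open>f\<close> may itself be an inner signed
  integral known only through a minorant.\<close>

lemma signed_integral_ge:
  assumes [measurable]: "P \<in> borel_measurable M" "N \<in> borel_measurable M" "A \<in> sets M"
    and N: "(\<integral>\<^sup>+x\<in>A. N x \<partial>M) < \<infinity>"
    and f: "AE x in M. x \<in> A \<longrightarrow> enn2ereal (P x) - enn2ereal (N x) \<le> f x"
  shows "enn2ereal (\<integral>\<^sup>+x\<in>A. P x \<partial>M) - enn2ereal (\<integral>\<^sup>+x\<in>A. N x \<partial>M) \<le> signed_integral A f"
proof -
  have fin: "AE x in M. x \<in> A \<longrightarrow> N x \<noteq> top"
  proof -
    have "AE x in M. N x * indicator A x \<noteq> \<infinity>"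
      using N by (intro nn_integral_PInf_AE) auto
    then show ?thesis by eventually_elim (auto simp: indicator_def)
  qed
  have pos: "(\<integral>\<^sup>+x\<in>A. (P x - N x) \<partial>M) \<le> (\<integral>\<^sup>+x\<in>A. e2ennreal (f x) \<partial>M)"
  proof (rule nn_integral_mono_AE)
    show "AE x in M. (P x - N x) * indicator A x \<le> e2ennreal (f x) * indicator A x"
      using f fin
    proof eventually_elim
      case (elim x)
      then show ?case
        using e2ennreal_diff_enn2ereal(1)[of "N x" "P x"] e2ennreal_mono[of "enn2ereal (P x) - enn2ereal (N x)" "f x"]
        by (cases "x \<in> A") auto
    qed
  qed
  have neg: "(\<integral>\<^sup>+x\<in>A. e2ennreal (- f x) \<partial>M) \<le> (\<integral>\<^sup>+x\<in>A. (N x - P x) \<partial>M)"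
  proof (rule nn_integral_mono_AE)
    show "AE x in M. e2ennreal (- f x) * indicator A x \<le> (N x - P x) * indicator A x"
      using f fin
    proof eventually_elim
      case (elim x)
      then show ?case
        using e2ennreal_diff_enn2ereal(2)[of "N x" "P x"] e2ennreal_mono[of "- f x" "- (enn2ereal (P x) - enn2ereal (N x))"]
        by (cases "x \<in> A") auto
    qed
  qed
  have "(\<integral>\<^sup>+x\<in>A. (P x - N x) \<partial>M) + (\<integral>\<^sup>+x\<in>A. N x \<partial>M)
      = (\<integral>\<^sup>+x. (P x - N x) * indicator A x + N x * indicator A x \<partial>M)"
    by (rule nn_integral_add[symmetric]) auto
  also have "\<dots> = (\<integral>\<^sup>+x. P x * indicator A x + (N x - P x) * indicator A x \<partial>M)"
  proof (rule nn_integral_cong_AE)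
    show "AE x in M. (P x - N x) * indicator A x + N x * indicator A x
        = P x * indicator A x + (N x - P x) * indicator A x"
      using fin
    proof eventually_elim
      case (elim x)
      then show ?case
        using ennreal_diff_add_eq_max[of "P x" "N x"] ennreal_diff_add_eq_max[of "N x" "P x"]
        by (simp add: indicator_def max.commute add.commute)
    qed
  qed
  also have "\<dots> = (\<integral>\<^sup>+x\<in>A. P x \<partial>M) + (\<integral>\<^sup>+x\<in>A. (N x - P x) \<partial>M)"
    by (rule nn_integral_add) auto
  finally have eq: "(\<integral>\<^sup>+x\<in>A. (P x - N x) \<partial>M) + (\<integral>\<^sup>+x\<in>A. N x \<partial>M)
     = (\<integral>\<^sup>+x\<in>A. P x \<partial>M) + (\<integral>\<^sup>+x\<in>A. (N x - P x) \<partial>M)" .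
  have "(\<integral>\<^sup>+x\<in>A. (N x - P x) \<partial>M) \<le> (\<integral>\<^sup>+x\<in>A. N x \<partial>M)"
    by (intro nn_integral_mono) (auto simp: indicator_def intro: diff_le_self_ennreal)
  with N have fin': "(\<integral>\<^sup>+x\<in>A. (N x - P x) \<partial>M) < \<infinity>" by order
  show ?thesis
    unfolding signed_integral_def
    using enn2ereal_diff_mono[OF eq pos neg] N fin' by (simp add: less_top)
qed

end

section \<open>Volumes of balls under the doubling condition\<close>

locale doubling_space = metric_measure_space +
  fixes Cmu :: real
  assumes doubling: "doubling_measure Cmu"
begin

definition vol :: "'a \<Rightarrow> real \<Rightarrow> real" where
  "vol x r = measure M (mball x r)"

lemma emeasure_mball_finite: "x \<in> X \<Longrightarrow> emeasure M (mball x r) < \<infinity>"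
  using doubling mball_eq_empty[of x r]
  by (cases "0 < r") (auto simp: doubling_measure_def emeasure_M)

lemma emeasure_mball: "x \<in> X \<Longrightarrow> emeasure M (mball x r) = ennreal (vol x r)"
  unfolding vol_def using emeasure_mball_finite[of x r]
  by (intro emeasure_eq_ennreal_measure) auto

lemma vol_pos: "x \<in> X \<Longrightarrow> 0 < r \<Longrightarrow> 0 < vol x r"
  using doubling emeasure_mball[of x r]
  by (auto simp: doubling_measure_def emeasure_M) (metis ennreal_less_zero_iff)

lemma Cmu_pos: "0 < Cmu"
  using doubling by (simp add: doubling_measure_def)

lemma vol_double:
  assumes "x \<in> X" "0 < r"
  shows "vol x (2 * r) \<le> Cmu * vol x r"
proof -
  have "ennreal (vol x (2 * r)) \<le> ennreal Cmu * ennreal (vol x r)"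
    using doubling assms by (auto simp flip: emeasure_mball simp: emeasure_M doubling_measure_def)
  then show ?thesis
    using Cmu_pos vol_pos[OF assms] by (simp flip: ennreal_mult)
qed

lemma vol_double_power:
  assumes "x \<in> X" "0 < r"
  shows "vol x (2 ^ n * r) \<le> Cmu ^ n * vol x r"
proof (induction n)
  case (Suc n)
  have "vol x (2 * (2 ^ n * r)) \<le> Cmu * vol x (2 ^ n * r)"
    using assms by (intro vol_double) auto
  also have "\<dots> \<le> Cmu * (Cmu ^ n * vol x r)"
    using Suc Cmu_pos by (intro mult_left_mono) auto
  finally show ?case by (simp add: mult_ac)
qed simp

lemma vol_mono:
  assumes "mball x r \<subseteq> mball y t" "y \<in> X"
  shows "vol x r \<le> vol y t"
  unfolding vol_def using assms emeasure_mball_finite[of y t]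
  by (intro measure_mono_fmeasurable) (auto simp: fmeasurable_def)

lemma Cmu_ge_1: "1 \<le> Cmu"
proof -
  obtain x where x: "x \<in> X" using nonempty by auto
  have "vol x 1 \<le> vol x (2 * 1)"
    using x by (intro vol_mono mball_subset_concentric) auto
  also have "\<dots> \<le> Cmu * vol x 1"
    using x by (intro vol_double) auto
  finally show ?thesis
    using vol_pos[OF x, of 1] by auto
qed

sublocale sigma_finite_measure M
proof
  obtain x where x: "x \<in> X" using nonempty by auto
  have "(\<Union>n. mball x (real n)) = X"
  proof (safe)
    fix y assume "y \<in> X"
    obtain n where "d x y < real n" using reals_Archimedean2 by blast
    then show "y \<in> (\<Union>n. mball x (real n))" using x \<open>y \<in> X\<close> by auto
  qed auto
  then show "\<exists>A. countable A \<and> A \<subseteq> sets M \<and> \<Union> A = space M \<and> (\<forall>a\<in>A. emeasure M a \<noteq> \<infinity>)"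
    using emeasure_mball_finite[OF x, THEN less_imp_neq]
    by (intro exI[of _ "range (\<lambda>n. mball x (real n))"]) auto
qed


section \<open>The kernel: measurability, pointwise bounds and integrals\<close>

definition kern :: "real \<Rightarrow> 'a \<Rightarrow> 'a \<Rightarrow> real" where
  "kern s x y = 1 / (measure M (mball x (d x y) \<union> mball y (d x y)) * d x y powr s)"

lemma kern_nonneg [simp]: "0 \<le> kern s x y"
  by (simp add: kern_def)

lemma kern_commute: "kern s x y = kern s y x"
  by (simp add: kern_def commute Un_commute)

lemma kern_self [simp]: "x \<in> X \<Longrightarrow> kern s x x = 0"
  by (simp add: kern_def)

lemma emeasure_Un_mball:
  assumes "x \<in> X" "y \<in> X"
  shows "emeasure M (mball x r \<union> mball y t) = ennreal (measure M (mball x r \<union> mball y t))"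
proof -
  have "emeasure M (mball x r \<union> mball y t) \<le> emeasure M (mball x r) + emeasure M (mball y t)"
    by (intro emeasure_subadditive) auto
  also have "\<dots> < \<infinity>" using emeasure_mball_finite assms by (auto simp: ennreal_add_less_top)
  finally show ?thesis by (intro emeasure_eq_ennreal_measure) auto
qed

lemma kernel_denom_eq:
  assumes "x \<in> X" "y \<in> X"
  shows "kernel_denom s x y
    = ennreal (measure M (mball x (d x y) \<union> mball y (d x y)) * d x y powr s)"
proof -
  have "mu (mball x (d x y) \<union> mball y (d x y)) = emeasure M (mball x (d x y) \<union> mball y (d x y))"
    by (intro emeasure_M[symmetric]) auto
  then show ?thesis
    using emeasure_Un_mball[OF assms] by (simp add: kernel_denom_def ennreal_mult)
qed

lemma vol_le_measure_Un:
  assumes "x \<in> X" "y \<in> X" "a \<le> d x y"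
  shows "vol y a \<le> measure M (mball x (d x y) \<union> mball y (d x y))"
proof -
  have "mball y a \<subseteq> mball x (d x y) \<union> mball y (d x y)" using assms by auto
  then show ?thesis
    unfolding vol_def using emeasure_Un_mball[OF assms(1,2)]
    by (intro measure_mono_fmeasurable) (auto simp: fmeasurable_def)
qed

lemma measure_Un_pos:
  assumes "x \<in> X" "y \<in> X" "x \<noteq> y"
  shows "0 < measure M (mball x (d x y) \<union> mball y (d x y))"
  using vol_le_measure_Un[OF assms(1,2), of "d x y"] vol_pos[OF assms(2), of "d x y"] assms
    mdist_pos_less[of x y] by auto

lemma kern_le:
  assumes "x \<in> X" "y \<in> X" "0 < a" "a \<le> d x y" "0 < s"
  shows "kern s x y \<le> 1 / (vol y a * a powr s)"
proof -
  have "x \<noteq> y" using assms by auto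
  have "vol y a * a powr s \<le> measure M (mball x (d x y) \<union> mball y (d x y)) * d x y powr s"
    using assms vol_pos[of y a] by (intro mult_mono vol_le_measure_Un powr_mono2) auto
  then show ?thesis
    unfolding kern_def using vol_pos[of y a] assms measure_Un_pos[of x y] \<open>x \<noteq> y\<close>
    by (intro divide_left_mono mult_pos_pos) auto
qed

text \<open>Both balls lie in \<open>mball y (2 * r)\<close>, so one doubling compares their union
  with \<open>mball y r\<close>. The points must differ because \<open>kern\<close> is
  \<open>0\<close> on the diagonal.\<close>

lemma kern_ge:
  assumes "x \<in> X" "y \<in> X" "x \<noteq> y" "d x y < r" "0 < s"
  shows "1 / (Cmu * vol y r * r powr s) \<le> kern s x y"
proof -
  have d: "0 < d x y" using assms by auto
  then have r: "0 < r" using assms by linarith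
  have "mball x (d x y) \<union> mball y (d x y) \<subseteq> mball y (2 * r)"
  proof
    fix z assume z: "z \<in> mball x (d x y) \<union> mball y (d x y)"
    then have "d y z \<le> d y x + d x z" using assms by (intro triangle) auto
    then show "z \<in> mball y (2 * r)" using z assms r by (auto simp: commute)
  qed
  then have "measure M (mball x (d x y) \<union> mball y (d x y)) \<le> vol y (2 * r)"
    unfolding vol_def using emeasure_mball_finite[of y "2 * r"] assms
    by (intro measure_mono_fmeasurable) (auto simp: fmeasurable_def)
  also have "\<dots> \<le> Cmu * vol y r"
    using assms r by (intro vol_double) auto
  finally have "measure M (mball x (d x y) \<union> mball y (d x y)) * d x y powr s
      \<le> Cmu * vol y r * r powr s"
    using assms d r Cmu_pos vol_pos[of y r] by (intro mult_mono powr_mono2) auto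
  then show ?thesis
    unfolding kern_def using measure_Un_pos assms d r Cmu_pos vol_pos[of y r]
    by (intro divide_left_mono mult_pos_pos) auto
qed

text \<open>On the diagonal \<open>kernel_denom\<close> is \<open>0\<close>, and so is
  \<open>kern\<close> as a division by zero; a numerator vanishing there makes both sides
  \<open>0\<close>.\<close>

lemma divide_kernel_denom_ereal:
  assumes "x \<in> X" "y \<in> X" "x = y \<Longrightarrow> g = 0"
  shows "ereal g / enn2ereal (kernel_denom s x y) = ereal (g * kern s x y)"
  using assms measure_Un_pos[of x y]
  by (cases "x = y") (auto simp: kernel_denom_eq kern_def zero_ereal_def[symmetric])

lemma divide_kernel_denom_ennreal:
  assumes "x \<in> X" "y \<in> X" "x = y \<Longrightarrow> g = 0" "0 \<le> g"
  shows "ennreal g / kernel_denom s x y = ennreal (g * kern s x y)"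
  using assms measure_Un_pos[of x y]
  by (cases "x = y") (auto simp: kernel_denom_eq kern_def divide_ennreal)

text \<open>The volume of the union is the measure of a section of a measurable set of triples,
  hence measurable in the pair of centres.\<close>

lemma measurable_kern [measurable]:
  "(\<lambda>p. kern s (fst p) (snd p)) \<in> borel_measurable (M \<Otimes>\<^sub>M M)"
proof -
  let ?N = "(M \<Otimes>\<^sub>M M) \<Otimes>\<^sub>M M"
  have d1: "(\<lambda>q. d (fst (fst q)) (snd q)) \<in> borel_measurable ?N"
    using measurable_compose[OF _ measurable_dist, of "\<lambda>q. (fst (fst q), snd q)" ?N] by simp
  have d2: "(\<lambda>q. d (snd (fst q)) (snd q)) \<in> borel_measurable ?N"
    using measurable_compose[OF _ measurable_dist, of "\<lambda>q. (snd (fst q), snd q)" ?N] by simp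
  have d3: "(\<lambda>q. d (fst (fst q)) (snd (fst q))) \<in> borel_measurable ?N"
    using measurable_compose[OF _ measurable_dist, of fst ?N] by simp
  define A where "A = {q \<in> space ?N. d (fst (fst q)) (snd q) < d (fst (fst q)) (snd (fst q)) \<or>
     d (snd (fst q)) (snd q) < d (fst (fst q)) (snd (fst q))}"
  have "A \<in> sets ?N"
    unfolding A_def using d1 d2 d3 by measurable
  then have "(\<lambda>p. emeasure M (Pair p -` A)) \<in> borel_measurable (M \<Otimes>\<^sub>M M)"
    by (rule measurable_emeasure_Pair)
  moreover have "Pair p -` A = mball (fst p) (d (fst p) (snd p)) \<union> mball (snd p) (d (fst p) (snd p))"
    if "p \<in> space (M \<Otimes>\<^sub>M M)" for p
    using that by (auto simp: A_def space_pair_measure)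
  ultimately have "(\<lambda>p. emeasure M (mball (fst p) (d (fst p) (snd p)) \<union> mball (snd p) (d (fst p) (snd p))))
      \<in> borel_measurable (M \<Otimes>\<^sub>M M)"
    by (simp cong: measurable_cong)
  then have [measurable]: "(\<lambda>p. measure M (mball (fst p) (d (fst p) (snd p)) \<union> mball (snd p) (d (fst p) (snd p))))
      \<in> borel_measurable (M \<Otimes>\<^sub>M M)"
    unfolding measure_def by measurable
  show ?thesis unfolding kern_def by measurable
qed

lemma measurable_kern_fst: "y \<in> X \<Longrightarrow> (\<lambda>x. kern s x y) \<in> borel_measurable M"
  using measurable_compose[OF measurable_Pair2'[of y M M] measurable_kern] by simp

lemma measurable_dist_fst: "y \<in> X \<Longrightarrow> (\<lambda>x. d x y) \<in> borel_measurable M"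
  using measurable_compose[OF measurable_Pair2'[of y M M] measurable_dist] by simp

text \<open>The kernel bound contains \<open>1 / vol y a\<close>, and the annulus has volume at most
  \<open>Cmu\<^sup>2 * vol y a\<close>, so the volumes cancel. The radius \<open>4 * a\<close> is
  two doublings of \<open>a\<close> and makes the open ball contain the sphere
  \<open>d x y = 2 * a\<close>.\<close>

lemma nn_integral_kern_annulus:
  assumes "y \<in> X" "0 < a" "0 < s"
  shows "(\<integral>\<^sup>+x. ennreal (kern s x y) * indicator {x. a \<le> d x y \<and> d x y \<le> 2 * a} x \<partial>M)
     \<le> ennreal (Cmu\<^sup>2 / a powr s)"
proof -
  have "(\<integral>\<^sup>+x. ennreal (kern s x y) * indicator {x. a \<le> d x y \<and> d x y \<le> 2 * a} x \<partial>M)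
     \<le> (\<integral>\<^sup>+x. ennreal (1 / (vol y a * a powr s)) * indicator (mball y (4 * a)) x \<partial>M)"
    using assms by (intro nn_integral_mono)
      (auto simp: indicator_def commute intro!: ennreal_leI kern_le)
  also have "\<dots> = ennreal (1 / (vol y a * a powr s)) * ennreal (vol y (4 * a))"
    using assms by (simp add: nn_integral_cmult_indicator emeasure_mball)
  also have "\<dots> = ennreal (1 / (vol y a * a powr s) * vol y (4 * a))"
    using assms by (intro ennreal_mult[symmetric]) (auto simp: vol_def)
  also have "\<dots> \<le> ennreal (1 / (vol y a * a powr s) * (Cmu\<^sup>2 * vol y a))"
    using vol_double_power[of y a 2] assms vol_pos[of y a]
    by (intro ennreal_leI mult_left_mono) auto
  also have "1 / (vol y a * a powr s) * (Cmu\<^sup>2 * vol y a) = Cmu\<^sup>2 / a powr s"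
    using assms vol_pos[of y a] by (simp add: field_simps)
  finally show ?thesis .
qed

text \<open>The dyadic series for \<open>d x y < \<delta>\<close> converges because \<open>s < 1\<close>, the one for
  \<open>d x y \<ge> \<delta>\<close> because \<open>s > 0\<close>.\<close>

lemma nn_integral_kern_lipschitz:
  assumes y: "y \<in> X" and \<delta>: "0 < \<delta>" and s: "0 < s" "s < 1"
    and g: "\<And>x. x \<in> X \<Longrightarrow> g x \<le> 1" "\<And>x. x \<in> X \<Longrightarrow> g x \<le> d x y / \<delta>"
  shows "(\<integral>\<^sup>+x. ennreal (g x * kern s x y) \<partial>M) \<le> ennreal (kernel_const s Cmu / \<delta> powr s)"
proof -
  let ?A = "\<lambda>a. {x. a \<le> d x y \<and> d x y \<le> 2 * a}"
  \<comment> \<open>\<open>?G n\<close> lives on the annuli outside radius \<open>\<delta>\<close>,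
    where \<open>g \<le> 1\<close> is used; \<open>?H n\<close> lives on those inside, where the
    Lipschitz bound gives \<open>g x \<le> 1 / 2 ^ n\<close>.\<close>
  let ?G = "\<lambda>n x. ennreal (kern s x y) * indicator (?A (2 ^ n * \<delta>)) x"
  let ?H = "\<lambda>n x. ennreal (1 / 2 ^ n) * (ennreal (kern s x y) * indicator (?A (\<delta> / 2 ^ Suc n)) x)"
  have [measurable]: "(\<lambda>x. kern s x y) \<in> borel_measurable M" "(\<lambda>x. d x y) \<in> borel_measurable M"
    using y by (auto intro: measurable_kern_fst measurable_dist_fst)
  have pt: "ennreal (g x * kern s x y) \<le> (\<Sum>n. ?H n x) + (\<Sum>n. ?G n x)" if x: "x \<in> X" for x
  proof (cases "x = y")
    case False
    then have d: "0 < d x y" using x y by auto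
    show ?thesis
    proof (cases "d x y < \<delta>")
      case True
      then have "1 \<le> \<delta> / d x y" using d by simp
      then obtain n where n: "2 ^ n \<le> \<delta> / d x y" "\<delta> / d x y \<le> 2 ^ Suc n"
        by (rule dyadic_bracket)
      then have n': "d x y \<le> \<delta> / 2 ^ n" "\<delta> / 2 ^ Suc n \<le> d x y"
        using d by (auto simp: field_simps)
      have "g x \<le> 1 / 2 ^ n"
      proof -
        have "d x y / \<delta> \<le> 1 / 2 ^ n"
          using n'(1) \<delta> by (simp add: pos_divide_le_eq)
        then show ?thesis using g(2)[OF x] by linarith
      qed
      then have "ennreal (g x * kern s x y) \<le> ennreal (1 / 2 ^ n * kern s x y)"
        by (intro ennreal_leI mult_right_mono) auto
      also have "\<dots> = ennreal (1 / 2 ^ n) * ennreal (kern s x y)"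
        by (intro ennreal_mult) auto
      also have "\<dots> = ?H n x"
        using n' by (simp add: indicator_def)
      also have "\<dots> \<le> (\<Sum>n. ?H n x)"
        by (rule le_suminf_ennreal)
      finally show ?thesis by (rule add_increasing2[OF zero_le])
    next
      case False
      then have "1 \<le> d x y / \<delta>" using d \<delta> by simp
      then obtain n where n: "2 ^ n \<le> d x y / \<delta>" "d x y / \<delta> \<le> 2 ^ Suc n"
        by (rule dyadic_bracket)
      then have n': "2 ^ n * \<delta> \<le> d x y" "d x y \<le> 2 * (2 ^ n * \<delta>)"
        using d \<delta> by (auto simp: field_simps)
      have "ennreal (g x * kern s x y) \<le> ennreal (1 * kern s x y)"
        using g(1)[OF x] by (intro ennreal_leI mult_right_mono) auto
      also have "\<dots> = ?G n x"
        using n' by (simp add: indicator_def)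
      also have "\<dots> \<le> (\<Sum>n. ?G n x)"
        by (rule le_suminf_ennreal)
      finally show ?thesis by (rule add_increasing[OF zero_le])
    qed
  qed (use y in simp)
  \<comment> \<open>The factor \<open>1 / 2 ^ n\<close> from the Lipschitz bound beats the growth
    \<open>2 powr (s * (n + 1))\<close> of the annulus bound and leaves the ratio
    \<open>2 powr (s - 1)\<close>.\<close>
  have H: "(\<integral>\<^sup>+x. ?H n x \<partial>M) \<le> ennreal (Cmu\<^sup>2 / \<delta> powr s * 2 powr s * (2 powr (s - 1)) ^ n)" for n
  proof -
    have "(\<integral>\<^sup>+x. ?H n x \<partial>M)
        = ennreal (1 / 2 ^ n) * (\<integral>\<^sup>+x. ennreal (kern s x y) * indicator (?A (\<delta> / 2 ^ Suc n)) x \<partial>M)"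
      by (rule nn_integral_cmult) measurable
    also have "\<dots> \<le> ennreal (1 / 2 ^ n) * ennreal (Cmu\<^sup>2 / (\<delta> / 2 ^ Suc n) powr s)"
      using y \<delta> s by (intro mult_left_mono nn_integral_kern_annulus) auto
    also have "\<dots> = ennreal (1 / 2 ^ n * (Cmu\<^sup>2 / (\<delta> / 2 ^ Suc n) powr s))"
      by (intro ennreal_mult[symmetric]) auto
    also have "1 / 2 ^ n * (Cmu\<^sup>2 / (\<delta> / 2 ^ Suc n) powr s)
        = Cmu\<^sup>2 / \<delta> powr s * 2 powr s * (2 powr (s - 1)) ^ n"
    proof -
      have "(2 ^ Suc n) powr s = 2 powr s * (2 powr s) ^ n"
        by (simp add: powr_mult powr_power powr_realpow[symmetric] powr_powr mult.commute powr_add[symmetric] algebra_simps)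
      moreover have "(2 powr (s - 1)) ^ n = (2 powr s) ^ n / 2 ^ n"
        by (simp add: powr_diff power_divide)
      ultimately show ?thesis using \<delta> by (simp add: powr_divide mult_ac)
    qed
    finally show ?thesis .
  qed
  have G: "(\<integral>\<^sup>+x. ?G n x \<partial>M) \<le> ennreal (Cmu\<^sup>2 / \<delta> powr s * (2 powr (- s)) ^ n)" for n
  proof -
    have "(\<integral>\<^sup>+x. ?G n x \<partial>M) \<le> ennreal (Cmu\<^sup>2 / (2 ^ n * \<delta>) powr s)"
      using y \<delta> s by (intro nn_integral_kern_annulus) auto
    also have "Cmu\<^sup>2 / (2 ^ n * \<delta>) powr s = Cmu\<^sup>2 / \<delta> powr s * (2 powr (- s)) ^ n"
    proof -
      have "(2 ^ n) powr s = (2 powr s) ^ n"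
        by (simp add: powr_power powr_realpow[symmetric] powr_powr mult.commute)
      moreover have "(2 powr (- s)) ^ n = 1 / (2 powr s) ^ n"
        by (simp add: powr_minus_divide power_divide)
      ultimately show ?thesis using \<delta> by (simp add: powr_mult mult_ac)
    qed
    finally show ?thesis .
  qed
  have q: "2 powr (s - 1) < 1" "2 powr (- s) < 1"
    using s powr_less_mono[of "s - 1" 0 2] powr_less_mono[of "-s" 0 2] by auto
  have sum1: "(\<Sum>n. ennreal (Cmu\<^sup>2 / \<delta> powr s * 2 powr s * (2 powr (s - 1)) ^ n))
      = ennreal (Cmu\<^sup>2 / \<delta> powr s * 2 powr s * (1 / (1 - 2 powr (s - 1))))"
    using q by (intro suminf_ennreal_eq sums_mult geometric_sums) auto
  have sum2: "(\<Sum>n. ennreal (Cmu\<^sup>2 / \<delta> powr s * (2 powr (- s)) ^ n))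
      = ennreal (Cmu\<^sup>2 / \<delta> powr s * (1 / (1 - 2 powr (- s))))"
    using q by (intro suminf_ennreal_eq sums_mult geometric_sums) auto
  have "(\<integral>\<^sup>+x. ennreal (g x * kern s x y) \<partial>M) \<le> (\<integral>\<^sup>+x. (\<Sum>n. ?H n x) + (\<Sum>n. ?G n x) \<partial>M)"
    using pt by (intro nn_integral_mono) auto
  also have "\<dots> = (\<integral>\<^sup>+x. (\<Sum>n. ?H n x) \<partial>M) + (\<integral>\<^sup>+x. (\<Sum>n. ?G n x) \<partial>M)"
    by (rule nn_integral_add) measurable
  also have "(\<integral>\<^sup>+x. (\<Sum>n. ?H n x) \<partial>M) = (\<Sum>n. \<integral>\<^sup>+x. ?H n x \<partial>M)"
    by (rule nn_integral_suminf) measurable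
  also have "(\<integral>\<^sup>+x. (\<Sum>n. ?G n x) \<partial>M) = (\<Sum>n. \<integral>\<^sup>+x. ?G n x \<partial>M)"
    by (rule nn_integral_suminf) measurable
  also have "(\<Sum>n. \<integral>\<^sup>+x. ?H n x \<partial>M) + (\<Sum>n. \<integral>\<^sup>+x. ?G n x \<partial>M)
     \<le> (\<Sum>n. ennreal (Cmu\<^sup>2 / \<delta> powr s * 2 powr s * (2 powr (s - 1)) ^ n))
      + (\<Sum>n. ennreal (Cmu\<^sup>2 / \<delta> powr s * (2 powr (- s)) ^ n))"
    by (intro add_mono suminf_le H G summableI)
  also have "\<dots> = ennreal (Cmu\<^sup>2 / \<delta> powr s * 2 powr s * (1 / (1 - 2 powr (s - 1))))
      + ennreal (Cmu\<^sup>2 / \<delta> powr s * (1 / (1 - 2 powr (- s))))"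
    by (simp only: sum1 sum2)
  also have "\<dots> = ennreal (Cmu\<^sup>2 / \<delta> powr s * 2 powr s * (1 / (1 - 2 powr (s - 1)))
      + Cmu\<^sup>2 / \<delta> powr s * (1 / (1 - 2 powr (- s))))"
    using q by (intro ennreal_plus[symmetric]) auto
  also have "Cmu\<^sup>2 / \<delta> powr s * 2 powr s * (1 / (1 - 2 powr (s - 1)))
      + Cmu\<^sup>2 / \<delta> powr s * (1 / (1 - 2 powr (- s))) = kernel_const s Cmu / \<delta> powr s"
    by (simp add: kernel_const_def algebra_simps add_divide_distrib)
  finally show ?thesis .
qed


section \<open>Testing subminimality with a cut-off truncation\<close>

lemma measurable_kern_raw [measurable (raw)]:
  "f \<in> measurable L M \<Longrightarrow> g \<in> measurable L M \<Longrightarrow> (\<lambda>p. kern s (f p) (g p)) \<in> borel_measurable L"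
  using measurable_compose[OF measurable_Pair measurable_kern, of f L g s] by simp

lemma measurable_dist_raw [measurable (raw)]:
  "f \<in> measurable L M \<Longrightarrow> g \<in> measurable L M \<Longrightarrow> (\<lambda>p. d (f p) (g p)) \<in> borel_measurable L"
  using measurable_compose[OF measurable_Pair measurable_dist, of f L g] by simp

text \<open>If \<open>u y\<close> is infinite, then \<open>\<bar>u x - u y\<bar>\<close> is infinite
  for every \<open>x\<close>, and so is the inner integral, a nonempty open \<open>\<Omega>\<close>
  having positive measure. A finite seminorm allows this only on a null set.\<close>

lemma AE_finite_of_W_dot:
  assumes \<Omega>: "openin mtopology \<Omega>" and u: "u \<in> borel_measurable M" "W_seminorm s \<Omega> u < \<infinity>"
  shows "AE x in M. x \<in> \<Omega> \<longrightarrow> \<bar>u x\<bar> \<noteq> \<infinity>"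
proof -
  have [measurable]: "u \<in> borel_measurable M" "\<Omega> \<in> sets M"
    using assms openin_sets_M by auto
  have sub: "\<Omega> \<subseteq> X" using sets.sets_into_space[of \<Omega> M] by simp
  define B where "B = {x \<in> space M. \<bar>u x\<bar> = \<infinity>} \<inter> \<Omega>"
  have B [measurable]: "B \<in> sets M" unfolding B_def by measurable
  have "\<infinity> * emeasure M B = 0"
  proof (cases "\<Omega> = {}")
    case False
    then obtain x r where "x \<in> \<Omega>" "0 < r" "mball x r \<subseteq> \<Omega>"
      using \<Omega> unfolding openin_mtopology by blast
    moreover have "x \<in> X" using sub \<open>x \<in> \<Omega>\<close> by auto
    ultimately have "0 < emeasure M (mball x r)" and "emeasure M (mball x r) \<le> emeasure M \<Omega>"
      by (auto simp: emeasure_mball vol_pos) (auto simp: emeasure_mball[symmetric] intro!: emeasure_mono)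
    then have "0 < emeasure M \<Omega>" by (rule less_le_trans)
    have "\<infinity> * indicator B y
        \<le> (\<integral>\<^sup>+x\<in>\<Omega>. (e2ennreal \<bar>u x - u y\<bar> / kernel_denom s x y) \<partial>M) * indicator \<Omega> y" for y
    proof (cases "y \<in> B")
      case True
      then have y: "y \<in> \<Omega>" "\<bar>u y\<bar> = \<infinity>" by (auto simp: B_def)
      have "(\<integral>\<^sup>+x\<in>\<Omega>. (e2ennreal \<bar>u x - u y\<bar> / kernel_denom s x y) \<partial>M) = (\<integral>\<^sup>+x\<in>\<Omega>. \<infinity> \<partial>M)"
      proof (intro nn_integral_cong)
        fix x
        have "e2ennreal \<bar>u x - u y\<bar> / kernel_denom s x y = \<infinity>" if "x \<in> \<Omega>"
        proof -
          have "\<bar>u x - u y\<bar> = \<infinity>" using y by (cases "u x"; cases "u y") auto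
          moreover have "kernel_denom s x y \<noteq> top"
            using kernel_denom_eq[OF subsetD[OF sub that] subsetD[OF sub y(1)], of s] by simp
          ultimately show ?thesis
            by (simp add: ennreal_top_divide)
        qed
        then show "e2ennreal \<bar>u x - u y\<bar> / kernel_denom s x y * indicator \<Omega> x = \<infinity> * indicator \<Omega> x"
          by (auto simp: indicator_def)
      qed
      also have "\<dots> = \<infinity>"
        using \<open>0 < emeasure M \<Omega>\<close>
        by (subst nn_integral_cmult_indicator) (auto simp: ennreal_top_mult)
      finally show ?thesis using y by simp
    qed (simp add: indicator_def)
    then have "(\<integral>\<^sup>+y. \<infinity> * indicator B y \<partial>M) \<le> W_seminorm s \<Omega> u"
      unfolding W_seminorm_def by (intro nn_integral_mono)
    with u(2) have "\<infinity> * emeasure M B < \<infinity>"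
      by (subst (asm) nn_integral_cmult_indicator) auto
    then show ?thesis by (auto simp: ennreal_top_mult split: if_splits)
  qed (simp add: B_def)
  then have "emeasure M B = 0" by simp
  with B show ?thesis
    by (intro AE_I[of _ _ B]) (auto simp: B_def)
qed

text \<open>The tested pair \<open>(x, y)\<close> is charged to a point of the support \<open>B\<close> of the cutoff;
  this is why no nonlocal tail of \<open>w\<close> appears.\<close>

definition cutoff_error :: "real \<Rightarrow> 'a set \<Rightarrow> ('a \<Rightarrow> real) \<Rightarrow> ('a \<Rightarrow> real) \<Rightarrow> 'a \<Rightarrow> 'a \<Rightarrow> real" where
  "cutoff_error s B \<phi> w x y =
     \<bar>\<phi> x - \<phi> y\<bar> * (w y * indicator B y + w x * indicator B x) * kern s x y"

text \<open>Interchanging \<open>x\<close> and \<open>y\<close> by Tonelli's theorem makes the two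
  summands equal, whence the factor \<open>2\<close>. Integrating first in the variable that carries
  no \<open>w\<close> leaves the kernel against a Lipschitz difference bounded by
  \<open>1\<close>.\<close>

lemma nn_integral_cutoff_error:
  assumes [measurable]: "\<phi> \<in> borel_measurable M" "w \<in> borel_measurable M" "B \<in> sets M"
    and w: "\<And>x. 0 \<le> w x" and \<phi>: "\<And>x. 0 \<le> \<phi> x" "\<And>x. \<phi> x \<le> 1"
    and lip: "\<And>x y. x \<in> X \<Longrightarrow> y \<in> X \<Longrightarrow> \<bar>\<phi> x - \<phi> y\<bar> \<le> d x y / \<delta>"
    and \<delta>: "0 < \<delta>" and s: "0 < s" "s < 1"
  shows "(\<integral>\<^sup>+y. \<integral>\<^sup>+x. ennreal (cutoff_error s B \<phi> w x y) \<partial>M \<partial>M)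
    \<le> ennreal (2 * kernel_const s Cmu / \<delta> powr s) * (\<integral>\<^sup>+x\<in>B. ennreal (w x) \<partial>M)"
proof -
  interpret pair_sigma_finite M M ..
  let ?h = "\<lambda>y. ennreal (w y) * indicator B y"
  let ?n = "\<lambda>x y. ?h y * ennreal (\<bar>\<phi> x - \<phi> y\<bar> * kern s x y)"
  let ?C = "ennreal (kernel_const s Cmu / \<delta> powr s)"
  have half: "(\<integral>\<^sup>+y. \<integral>\<^sup>+x. ?n x y \<partial>M \<partial>M) \<le> ?C * (\<integral>\<^sup>+x\<in>B. ennreal (w x) \<partial>M)"
  proof -
    have "(\<integral>\<^sup>+y. \<integral>\<^sup>+x. ?n x y \<partial>M \<partial>M) = (\<integral>\<^sup>+y. ?h y * (\<integral>\<^sup>+x. ennreal (\<bar>\<phi> x - \<phi> y\<bar> * kern s x y) \<partial>M) \<partial>M)"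
      by (intro nn_integral_cong nn_integral_cmult) simp
    also have "\<dots> \<le> (\<integral>\<^sup>+y. ?h y * ?C \<partial>M)"
    proof (intro nn_integral_mono mult_left_mono nn_integral_kern_lipschitz)
      show "\<bar>\<phi> x - \<phi> y\<bar> \<le> 1" for x y using \<phi>[of x] \<phi>[of y] by auto
    qed (use \<delta> s lip in auto)
    also have "\<dots> = ?C * (\<integral>\<^sup>+x\<in>B. ennreal (w x) \<partial>M)"
      by (subst mult.commute, rule nn_integral_cmult) simp
    finally show ?thesis .
  qed
  have "(\<integral>\<^sup>+y. \<integral>\<^sup>+x. ennreal (cutoff_error s B \<phi> w x y) \<partial>M \<partial>M)
     = (\<integral>\<^sup>+y. \<integral>\<^sup>+x. ?n x y + ?n y x \<partial>M \<partial>M)"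
  proof (intro nn_integral_cong)
    fix x y assume "x \<in> space M" "y \<in> space M"
    have "cutoff_error s B \<phi> w x y = (w y * indicator B y) * (\<bar>\<phi> x - \<phi> y\<bar> * kern s x y)
        + (w x * indicator B x) * (\<bar>\<phi> y - \<phi> x\<bar> * kern s y x)"
      by (simp add: cutoff_error_def kern_commute[of s x y] abs_minus_commute[of "\<phi> x"] algebra_simps)
    then show "ennreal (cutoff_error s B \<phi> w x y) = ?n x y + ?n y x"
      using w by (simp add: ennreal_mult[symmetric] ennreal_plus[symmetric] ennreal_indicator[symmetric]
        del: ennreal_plus ennreal_indicator)
  qed
  also have "\<dots> = (\<integral>\<^sup>+y. (\<integral>\<^sup>+x. ?n x y \<partial>M) + (\<integral>\<^sup>+x. ?n y x \<partial>M) \<partial>M)"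
    by (intro nn_integral_cong nn_integral_add) simp_all
  also have "\<dots> = (\<integral>\<^sup>+y. \<integral>\<^sup>+x. ?n x y \<partial>M \<partial>M) + (\<integral>\<^sup>+y. \<integral>\<^sup>+x. ?n y x \<partial>M \<partial>M)"
    by (rule nn_integral_add) measurable
  also have "(\<integral>\<^sup>+y. \<integral>\<^sup>+x. ?n y x \<partial>M \<partial>M) = (\<integral>\<^sup>+x. \<integral>\<^sup>+y. ?n y x \<partial>M \<partial>M)"
    by (rule Fubini') measurable
  also have "(\<integral>\<^sup>+y. \<integral>\<^sup>+x. ?n x y \<partial>M \<partial>M) + (\<integral>\<^sup>+x. \<integral>\<^sup>+y. ?n y x \<partial>M \<partial>M)
    \<le> ?C * (\<integral>\<^sup>+x\<in>B. ennreal (w x) \<partial>M) + ?C * (\<integral>\<^sup>+x\<in>B. ennreal (w x) \<partial>M)"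
    using half by (intro add_mono) auto
  also have "\<dots> = (?C + ?C) * (\<integral>\<^sup>+x\<in>B. ennreal (w x) \<partial>M)"
    by (simp add: distrib_right)
  also have "?C + ?C = ennreal (2 * kernel_const s Cmu / \<delta> powr s)"
    using s powr_less_mono[of "s - 1" 0 2] powr_less_mono[of "-s" 0 2]
    by (simp add: kernel_const_def ennreal_plus[symmetric] del: ennreal_plus)
  finally show ?thesis .
qed


text \<open>\<open>real_of_ereal\<close> sends infinite values to \<open>0\<close>, but wherever it
  does so the right side is already infinite.\<close>

lemma seminorm_integrand_ge:
  assumes "x \<in> X" "y \<in> X"
  shows "ennreal (\<bar>real_of_ereal (u x) - real_of_ereal (u y)\<bar> * kern s x y)
     \<le> e2ennreal \<bar>u x - u y\<bar> / kernel_denom s x y"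
proof (cases "\<bar>u x\<bar> = \<infinity> \<or> \<bar>u y\<bar> = \<infinity>")
  case True
  then have "\<bar>u x - u y\<bar> = \<infinity>" by (cases "u x"; cases "u y") auto
  moreover have "kernel_denom s x y \<noteq> top"
    using kernel_denom_eq[OF assms, of s] by simp
  ultimately show ?thesis
    by (simp add: ennreal_top_divide)
next
  case False
  then have "e2ennreal \<bar>u x - u y\<bar> = ennreal \<bar>real_of_ereal (u x) - real_of_ereal (u y)\<bar>"
    by (cases "u x"; cases "u y") auto
  then show ?thesis
    using divide_kernel_denom_ennreal[OF assms, of "\<bar>real_of_ereal (u x) - real_of_ereal (u y)\<bar>" s]
    by auto
qed

text \<open>Admissibility requires a finite seminorm on all of \<open>X\<close>, while that of
  \<open>u\<close> is finite only on \<open>\<Omega>\<close>. The oscillation of \<open>u\<close> is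
  therefore used only for pairs in \<open>\<Omega>\<close>; the cutoff error alone controls all
  other pairs, because the support lies in \<open>\<Omega>\<close>.\<close>

lemma cutoff_truncation_in_W0:
  assumes \<Omega>: "openin mtopology \<Omega>"
    and u: "u \<in> borel_measurable M" "W_seminorm s \<Omega> u < \<infinity>"
    and B: "B \<in> sets M" "B \<subseteq> \<Omega>"
    and m: "\<phi> \<in> borel_measurable M"
    and \<phi>: "\<And>x. 0 \<le> \<phi> x" "\<And>x. \<phi> x \<le> 1" "\<And>x. x \<in> X - B \<Longrightarrow> \<phi> x = 0"
    and w_def: "\<And>x. w x = max (real_of_ereal (u x) - k) 0"
    and w: "(\<integral>\<^sup>+x\<in>B. ennreal (w x) \<partial>M) < \<infinity>"
    and err: "(\<integral>\<^sup>+y. \<integral>\<^sup>+x. ennreal (cutoff_error s B \<phi> w x y) \<partial>M \<partial>M) < \<infinity>"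
  shows "(\<lambda>x. ereal (- (\<phi> x * w x))) \<in> W0 s \<Omega>"
proof -
  have [measurable]: "u \<in> borel_measurable M" "\<phi> \<in> borel_measurable M" "B \<in> sets M" "\<Omega> \<in> sets M"
    using \<Omega> u B m openin_sets_M by auto
  have [measurable]: "w \<in> borel_measurable M"
    unfolding w_def[abs_def] by measurable
  have sub: "\<Omega> \<subseteq> X" using sets.sets_into_space[of \<Omega> M] by simp
  have w0: "0 \<le> w x" for x by (simp add: w_def)
  let ?\<eta> = "\<lambda>x. ereal (- (\<phi> x * w x))"
  let ?U = "\<lambda>x. real_of_ereal (u x)"
  let ?a = "\<lambda>x y. ennreal (\<bar>?U x - ?U y\<bar> * kern s x y) * indicator \<Omega> x * indicator \<Omega> y"
  have "(\<integral>\<^sup>+x\<in>X. e2ennreal \<bar>?\<eta> x\<bar> \<partial>M) \<le> (\<integral>\<^sup>+x\<in>B. ennreal (w x) \<partial>M)"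
  proof (rule nn_integral_mono)
    fix x assume "x \<in> space M"
    then show "e2ennreal \<bar>?\<eta> x\<bar> * indicator X x \<le> ennreal (w x) * indicator B x"
      using \<phi>[of x] w0[of x] by (cases "x \<in> B") (auto simp: abs_mult intro!: ennreal_leI mult_left_le_one_le)
  qed
  with w have 1: "(\<integral>\<^sup>+x\<in>X. e2ennreal \<bar>?\<eta> x\<bar> \<partial>M) < \<infinity>" by order
  have pt: "e2ennreal \<bar>?\<eta> x - ?\<eta> y\<bar> / kernel_denom s x y
      \<le> ?a x y + ennreal (cutoff_error s B \<phi> w x y)" if "x \<in> X" "y \<in> X" for x y
  proof -
    have "e2ennreal \<bar>?\<eta> x - ?\<eta> y\<bar> = ennreal \<bar>\<phi> x * w x - \<phi> y * w y\<bar>"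
      by (simp add: abs_minus_commute)
    then have "e2ennreal \<bar>?\<eta> x - ?\<eta> y\<bar> / kernel_denom s x y
        = ennreal (\<bar>\<phi> x * w x - \<phi> y * w y\<bar> * kern s x y)"
      using divide_kernel_denom_ennreal[OF that, of "\<bar>\<phi> x * w x - \<phi> y * w y\<bar>" s] by auto
    also have "\<dots> \<le> ennreal ((\<bar>?U x - ?U y\<bar> * indicator \<Omega> x * indicator \<Omega> y
        + \<bar>\<phi> x - \<phi> y\<bar> * (w y * indicator B y + w x * indicator B x)) * kern s x y)"
    proof (intro ennreal_leI mult_right_mono)
      have le: "\<bar>w x - w y\<bar> \<le> \<bar>?U x - ?U y\<bar>" by (auto simp: w_def)
      show "\<bar>\<phi> x * w x - \<phi> y * w y\<bar> \<le> \<bar>?U x - ?U y\<bar> * indicator \<Omega> x * indicator \<Omega> y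
        + \<bar>\<phi> x - \<phi> y\<bar> * (w y * indicator B y + w x * indicator B x)"
        using that \<phi>(3)[of x] \<phi>(3)[of y] B(2)
        by (intro abs_cutoff_diff_le \<phi> w0 le) (auto simp: indicator_def)
    qed simp
    also have "\<dots> = ?a x y + ennreal (cutoff_error s B \<phi> w x y)"
    proof -
      have "(\<bar>?U x - ?U y\<bar> * indicator \<Omega> x * indicator \<Omega> y
        + \<bar>\<phi> x - \<phi> y\<bar> * (w y * indicator B y + w x * indicator B x)) * kern s x y
        = (\<bar>?U x - ?U y\<bar> * kern s x y) * indicator \<Omega> x * indicator \<Omega> y + cutoff_error s B \<phi> w x y"
        by (simp add: cutoff_error_def algebra_simps)
      moreover have "0 \<le> cutoff_error s B \<phi> w x y"
        using w0 by (simp add: cutoff_error_def)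
      ultimately show ?thesis
        by (auto simp: indicator_def)
    qed
    finally show ?thesis .
  qed
  have "W_seminorm s X ?\<eta> \<le> (\<integral>\<^sup>+y. \<integral>\<^sup>+x. ?a x y + ennreal (cutoff_error s B \<phi> w x y) \<partial>M \<partial>M)"
    unfolding W_seminorm_def
  proof (rule nn_integral_mono)
    fix y assume "y \<in> space M"
    then have y: "y \<in> X" by simp
    have "(\<integral>\<^sup>+x\<in>X. (e2ennreal \<bar>?\<eta> x - ?\<eta> y\<bar> / kernel_denom s x y) \<partial>M)
        \<le> (\<integral>\<^sup>+x. ?a x y + ennreal (cutoff_error s B \<phi> w x y) \<partial>M)"
    proof (rule nn_integral_mono)
      fix x assume "x \<in> space M"
      then have x: "x \<in> X" by simp
      show "e2ennreal \<bar>?\<eta> x - ?\<eta> y\<bar> / kernel_denom s x y * indicator X x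
          \<le> ?a x y + ennreal (cutoff_error s B \<phi> w x y)"
        using pt[OF x y] by (simp only: indicator_simps(1)[OF x] mult_1_right)
    qed
    then show "(\<integral>\<^sup>+x\<in>X. (e2ennreal \<bar>?\<eta> x - ?\<eta> y\<bar> / kernel_denom s x y) \<partial>M) * indicator X y
        \<le> (\<integral>\<^sup>+x. ?a x y + ennreal (cutoff_error s B \<phi> w x y) \<partial>M)"
      by (simp only: indicator_simps(1)[OF y] mult_1_right)
  qed
  also have "\<dots> = (\<integral>\<^sup>+y. (\<integral>\<^sup>+x. ?a x y \<partial>M) + (\<integral>\<^sup>+x. ennreal (cutoff_error s B \<phi> w x y) \<partial>M) \<partial>M)"
    unfolding cutoff_error_def by (intro nn_integral_cong nn_integral_add) simp_all
  also have "\<dots> = (\<integral>\<^sup>+y. \<integral>\<^sup>+x. ?a x y \<partial>M \<partial>M)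
      + (\<integral>\<^sup>+y. \<integral>\<^sup>+x. ennreal (cutoff_error s B \<phi> w x y) \<partial>M \<partial>M)"
    unfolding cutoff_error_def by (rule nn_integral_add) measurable
  also have "(\<integral>\<^sup>+y. \<integral>\<^sup>+x. ?a x y \<partial>M \<partial>M) \<le> W_seminorm s \<Omega> u"
    unfolding W_seminorm_def
  proof (rule nn_integral_mono)
    fix y assume y: "y \<in> space M"
    show "(\<integral>\<^sup>+x. ?a x y \<partial>M)
      \<le> (\<integral>\<^sup>+x\<in>\<Omega>. (e2ennreal \<bar>u x - u y\<bar> / kernel_denom s x y) \<partial>M) * indicator \<Omega> y"
    proof (cases "y \<in> \<Omega>")
      case True
      then show ?thesis
        using y seminorm_integrand_ge[of _ y u s]
        by (auto intro!: nn_integral_mono mult_right_mono)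
    qed simp
  qed
  finally have "W_seminorm s X ?\<eta> < \<infinity>"
    using u err by (auto simp: less_top[symmetric] top_unique)
  with 1 have "W_norm s X ?\<eta> < \<infinity>"
    by (simp add: W_norm_def)
  moreover have "?\<eta> \<in> borel_measurable (restrict_space M X)"
    by (intro measurable_restrict_space1) measurable
  ultimately show ?thesis
    using \<phi>(3) B(2) by (auto simp: W0_def W_def intro!: AE_I2)
qed

text \<open>The test function \<open>- (\<phi> x * w x)\<close> makes the integrand of
  \<open>F\<close> at least a gain \<open>P\<close> minus the error \<open>N\<close>. The gain comes
  from pairs with \<open>w x = 0\<close>, where lowering \<open>w y\<close> shortens the jump by
  exactly \<open>\<phi> y * w y\<close>. The factor \<open>3\<close> counts pairs inside
  \<open>\<Omega>\<close> once and pairs with \<open>x\<close> in the complement twice.\<close>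

lemma subminimizer_cutoff:
  assumes \<Omega>: "openin mtopology \<Omega>" and u: "subminimizer s \<Omega> u"
    and B: "B \<in> sets M" "B \<subseteq> \<Omega>"
    and m: "\<phi> \<in> borel_measurable M"
    and \<phi>: "\<And>x. 0 \<le> \<phi> x" "\<And>x. \<phi> x \<le> 1" "\<And>x. x \<in> X - B \<Longrightarrow> \<phi> x = 0"
    and w_def: "\<And>x. w x = max (real_of_ereal (u x) - k) 0"
    and w: "(\<integral>\<^sup>+x\<in>B. ennreal (w x) \<partial>M) < \<infinity>"
    and err: "(\<integral>\<^sup>+y. \<integral>\<^sup>+x. ennreal (cutoff_error s B \<phi> w x y) \<partial>M \<partial>M) < \<infinity>"
  shows "(\<integral>\<^sup>+y\<in>\<Omega>. (\<integral>\<^sup>+x. ennreal ((if w x = 0 then \<phi> y * w y else 0) * kern s x y) \<partial>M) \<partial>M)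
     \<le> 3 * (\<integral>\<^sup>+y. \<integral>\<^sup>+x. ennreal (cutoff_error s B \<phi> w x y) \<partial>M \<partial>M)"
proof -
  have u_meas [measurable]: "u \<in> borel_measurable M" and sem: "W_seminorm s \<Omega> u < \<infinity>"
    using u by (auto simp: subminimizer_def W_dot_def)
  have [measurable]: "\<phi> \<in> borel_measurable M" "B \<in> sets M" "\<Omega> \<in> sets M"
    using \<Omega> B m openin_sets_M by auto
  have w_meas [measurable]: "w \<in> borel_measurable M"
    unfolding w_def[abs_def] by measurable
  have sub: "\<Omega> \<subseteq> X" using sets.sets_into_space[of \<Omega> M] by simp
  have w0: "0 \<le> w x" for x by (simp add: w_def)
  define P where "P x y = (if w x = 0 then \<phi> y * w y else 0) * kern s x y" for x y
  define N where "N x y = cutoff_error s B \<phi> w x y" for x y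
  have P0: "0 \<le> P x y" for x y using w0 \<phi> by (auto simp: P_def)
  have N0: "0 \<le> N x y" for x y using w0 by (auto simp: N_def cutoff_error_def)
  have [measurable]: "(\<lambda>(y, x). P x y) \<in> borel_measurable (M \<Otimes>\<^sub>M M)"
    "(\<lambda>(y, x). N x y) \<in> borel_measurable (M \<Otimes>\<^sub>M M)"
    unfolding P_def N_def cutoff_error_def by measurable
  have [measurable]: "(\<lambda>x. P x y) \<in> borel_measurable M" "(\<lambda>x. N x y) \<in> borel_measurable M"
    if [measurable]: "y \<in> space M" for y
    unfolding P_def N_def cutoff_error_def by measurable
  let ?\<eta> = "\<lambda>x. ereal (- (\<phi> x * w x))"
  define v where "v x = u x + ?\<eta> x" for x
  define f where "f x y = (\<bar>u x - u y\<bar> - \<bar>v x - v y\<bar>) / enn2ereal (kernel_denom s x y)" for x y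
  have "?\<eta> \<in> W0 s \<Omega>"
    using cutoff_truncation_in_W0[OF \<Omega> u_meas sem B m \<phi> w_def w err] .
  then have "F s \<Omega> u v \<le> 0"
    using u \<phi> w0 unfolding subminimizer_def v_def[abs_def] by auto
  then have F: "signed_integral \<Omega> (\<lambda>y. signed_integral \<Omega> (\<lambda>x. f x y))
     + 2 * signed_integral \<Omega> (\<lambda>y. signed_integral (X - \<Omega>) (\<lambda>x. f x y)) \<le> 0"
    by (simp add: F_def f_def[abs_def] Let_def)
  have pt: "enn2ereal (ennreal (P x y)) - enn2ereal (ennreal (N x y)) \<le> f x y"
    if x: "x \<in> X" and y: "y \<in> \<Omega>" "\<bar>u y\<bar> \<noteq> \<infinity>" for x y
  proof -
    have yX: "y \<in> X" using y sub by auto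
    obtain b where b: "u y = ereal b" using y by auto
    have lhs: "enn2ereal (ennreal (P x y)) - enn2ereal (ennreal (N x y)) = ereal (P x y - N x y)"
      using P0[of x y] N0[of x y] by simp
    show ?thesis
    proof (cases "\<bar>u x\<bar> = \<infinity>")
      case True
      \<comment> \<open>\<open>\<infinity> - \<infinity> = \<infinity>\<close> in \<open>ereal\<close>, so infinite values of \<open>u\<close> outside \<open>\<Omega>\<close> only increase \<open>F\<close>\<close>
      then have "x \<noteq> y" using y by auto
      have "kernel_denom s x y = ennreal (measure M (mball x (d x y) \<union> mball y (d x y)) * d x y powr s)"
        using x yX by (rule kernel_denom_eq)
      moreover have "0 < measure M (mball x (d x y) \<union> mball y (d x y)) * d x y powr s"
        using measure_Un_pos[OF x yX \<open>x \<noteq> y\<close>] x yX \<open>x \<noteq> y\<close> by simp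
      ultimately have "f x y = \<infinity>"
        using True b by (cases "u x") (auto simp: f_def v_def)
      then show ?thesis by simp
    next
      case False
      then obtain a where a: "u x = ereal a" by auto
      let ?g = "\<bar>a - b\<bar> - \<bar>(a - \<phi> x * w x) - (b - \<phi> y * w y)\<bar>"
      have "f x y = ereal ?g / enn2ereal (kernel_denom s x y)"
        by (simp add: f_def v_def a b)
      also have "\<dots> = ereal (?g * kern s x y)"
        using x yX a b by (intro divide_kernel_denom_ereal) auto
      finally have f: "f x y = ereal (?g * kern s x y)" .
      have "?g = \<bar>w x - w y\<bar> - \<bar>(1 - \<phi> x) * w x - (1 - \<phi> y) * w y\<bar>"
        using abs_diff_truncation[of "\<phi> x" "\<phi> y" a b k] \<phi> by (simp add: w_def a b)
      moreover have "(if w x = 0 then \<phi> y * w y else 0) - \<bar>\<phi> x - \<phi> y\<bar> * (w y * indicator B y + w x * indicator B x)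
         \<le> \<bar>w x - w y\<bar> - \<bar>(1 - \<phi> x) * w x - (1 - \<phi> y) * w y\<bar>"
        using \<phi>(3)[of x] \<phi>(3)[of y] x yX
        by (intro abs_diff_cutoff_ge \<phi> w0) (auto simp: indicator_def)
      ultimately have "((if w x = 0 then \<phi> y * w y else 0) - \<bar>\<phi> x - \<phi> y\<bar> * (w y * indicator B y + w x * indicator B x))
          * kern s x y \<le> ?g * kern s x y"
        by (intro mult_right_mono) auto
      then have "P x y - N x y \<le> ?g * kern s x y"
        by (simp add: P_def N_def cutoff_error_def left_diff_distrib)
      then show ?thesis unfolding lhs f by simp
    qed
  qed
  have uniform: "(\<integral>\<^sup>+y\<in>\<Omega>. (\<integral>\<^sup>+x\<in>A. ennreal (N x y) \<partial>M) \<partial>M) \<le> (\<integral>\<^sup>+y. \<integral>\<^sup>+x. ennreal (N x y) \<partial>M \<partial>M)" for A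
  proof (rule nn_integral_mono)
    fix y
    have "(\<integral>\<^sup>+x\<in>A. ennreal (N x y) \<partial>M) \<le> (\<integral>\<^sup>+x. ennreal (N x y) \<partial>M)"
      by (intro nn_integral_mono) (simp add: indicator_def)
    then show "(\<integral>\<^sup>+x\<in>A. ennreal (N x y) \<partial>M) * indicator \<Omega> y \<le> (\<integral>\<^sup>+x. ennreal (N x y) \<partial>M)"
      by (cases "y \<in> \<Omega>") simp_all
  qed
  have fin: "AE y in M. (\<integral>\<^sup>+x. ennreal (N x y) \<partial>M) \<noteq> \<infinity>"
    using err by (intro nn_integral_PInf_AE) (auto simp: N_def[symmetric])
  \<comment> \<open>\<open>signed_integral_ge\<close> is applied to the outer integral; its minorant
    comes from a second application to the inner one, for almost every \<open>y\<close> with finite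
    inner error and finite \<open>u y\<close>.\<close>
  have ge: "enn2ereal (\<integral>\<^sup>+y\<in>\<Omega>. (\<integral>\<^sup>+x\<in>A. ennreal (P x y) \<partial>M) \<partial>M)
      - enn2ereal (\<integral>\<^sup>+y\<in>\<Omega>. (\<integral>\<^sup>+x\<in>A. ennreal (N x y) \<partial>M) \<partial>M)
     \<le> signed_integral \<Omega> (\<lambda>y. signed_integral A (\<lambda>x. f x y))" if [measurable]: "A \<in> sets M" for A
  proof (rule signed_integral_ge)
    show "(\<integral>\<^sup>+y\<in>\<Omega>. (\<integral>\<^sup>+x\<in>A. ennreal (N x y) \<partial>M) \<partial>M) < \<infinity>"
      using uniform[of A] err by (auto simp: N_def intro: le_less_trans)
    show "AE y in M. y \<in> \<Omega> \<longrightarrow> enn2ereal (\<integral>\<^sup>+x\<in>A. ennreal (P x y) \<partial>M)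
        - enn2ereal (\<integral>\<^sup>+x\<in>A. ennreal (N x y) \<partial>M) \<le> signed_integral A (\<lambda>x. f x y)"
      using fin AE_finite_of_W_dot[OF \<Omega> u_meas sem] AE_space
    proof eventually_elim
      case (elim y)
      show ?case
      proof
        assume y: "y \<in> \<Omega>"
        show "enn2ereal (\<integral>\<^sup>+x\<in>A. ennreal (P x y) \<partial>M)
          - enn2ereal (\<integral>\<^sup>+x\<in>A. ennreal (N x y) \<partial>M) \<le> signed_integral A (\<lambda>x. f x y)"
        proof (rule signed_integral_ge)
          have "(\<integral>\<^sup>+x\<in>A. ennreal (N x y) \<partial>M) \<le> (\<integral>\<^sup>+x. ennreal (N x y) \<partial>M)"
            by (intro nn_integral_mono) (auto simp: indicator_def)
          with elim show "(\<integral>\<^sup>+x\<in>A. ennreal (N x y) \<partial>M) < \<infinity>"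
            by (auto simp: less_top[symmetric] top_unique)
          show "AE x in M. x \<in> A \<longrightarrow> enn2ereal (ennreal (P x y)) - enn2ereal (ennreal (N x y)) \<le> f x y"
            using pt[OF _ y] elim y by (intro AE_I2) auto
        qed (use elim in measurable)
      qed
    qed
  qed measurable
  let ?p1 = "\<integral>\<^sup>+y\<in>\<Omega>. (\<integral>\<^sup>+x\<in>\<Omega>. ennreal (P x y) \<partial>M) \<partial>M"
  let ?p2 = "\<integral>\<^sup>+y\<in>\<Omega>. (\<integral>\<^sup>+x\<in>X - \<Omega>. ennreal (P x y) \<partial>M) \<partial>M"
  let ?n1 = "\<integral>\<^sup>+y\<in>\<Omega>. (\<integral>\<^sup>+x\<in>\<Omega>. ennreal (N x y) \<partial>M) \<partial>M"
  let ?n2 = "\<integral>\<^sup>+y\<in>\<Omega>. (\<integral>\<^sup>+x\<in>X - \<Omega>. ennreal (N x y) \<partial>M) \<partial>M"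
  let ?n = "\<integral>\<^sup>+y. \<integral>\<^sup>+x. ennreal (N x y) \<partial>M \<partial>M"
  have X\<Omega> [measurable]: "X - \<Omega> \<in> sets M"
    using sets.compl_sets[of \<Omega> M] by simp
  have "?p1 + ?p2 \<le> 3 * ?n"
  proof -
    \<comment> \<open>Finite errors exclude infinite gains, as the left side would then be
      \<open>\<infinity>\<close>. What remains is \<open>p1 + 2 * p2 \<le> n1 + 2 * n2\<close>,
      where one copy of \<open>p2\<close> is dropped.\<close>
    have le: "p1 + p2 \<le> 3 * n"
      if "enn2ereal p1 - enn2ereal n1 + 2 * (enn2ereal p2 - enn2ereal n2) \<le> 0"
        "n1 \<le> n" "n2 \<le> n" "n < \<infinity>" for p1 p2 n1 n2 n :: ennreal
    proof -
      have "n1 \<noteq> top" "n2 \<noteq> top" "n \<noteq> top" using that by (auto simp: top_unique)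
      then obtain r1 r2 r where r: "n1 = ennreal r1" "n2 = ennreal r2" "n = ennreal r"
          "0 \<le> r1" "0 \<le> r2" "0 \<le> r"
        by (cases n1; cases n2; cases n) auto
      have "p1 \<noteq> top" "p2 \<noteq> top"
        using that(1) r by (cases p1; cases p2; auto)+
      then obtain t1 t2 where t: "p1 = ennreal t1" "p2 = ennreal t2" "0 \<le> t1" "0 \<le> t2"
        by (cases p1; cases p2) auto
      have "t1 - r1 + 2 * (t2 - r2) \<le> 0"
        using that(1) r t by (simp add: zero_ereal_def numeral_eq_ereal)
      moreover have "r1 \<le> r" "r2 \<le> r" using that(2,3) r by auto
      ultimately have "t1 + t2 \<le> 3 * r" using t(3,4) by argo
      then have "ennreal (t1 + t2) \<le> ennreal (3 * r)" by (rule ennreal_leI)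
      then show ?thesis using r t by (simp add: ennreal_mult)
    qed
    have "enn2ereal ?p1 - enn2ereal ?n1 + 2 * (enn2ereal ?p2 - enn2ereal ?n2) \<le> 0"
      by (rule order_trans[OF _ F]) (intro add_mono ereal_mult_left_mono ge; simp)
    then show ?thesis
      using uniform err by (intro le) (auto simp: N_def)
  qed
  moreover have "(\<integral>\<^sup>+y\<in>\<Omega>. (\<integral>\<^sup>+x. ennreal (P x y) \<partial>M) \<partial>M) = ?p1 + ?p2"
  proof -
    have "(\<integral>\<^sup>+y\<in>\<Omega>. (\<integral>\<^sup>+x. ennreal (P x y) \<partial>M) \<partial>M)
      = (\<integral>\<^sup>+y. (\<integral>\<^sup>+x\<in>\<Omega>. ennreal (P x y) \<partial>M) * indicator \<Omega> y
          + (\<integral>\<^sup>+x\<in>X - \<Omega>. ennreal (P x y) \<partial>M) * indicator \<Omega> y \<partial>M)"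
    proof (rule nn_integral_cong)
      fix y assume [measurable]: "y \<in> space M"
      have "(\<integral>\<^sup>+x. ennreal (P x y) \<partial>M) = (\<integral>\<^sup>+x. ennreal (P x y) * indicator \<Omega> x
          + ennreal (P x y) * indicator (X - \<Omega>) x \<partial>M)"
        by (intro nn_integral_cong) (auto simp: indicator_def)
      also have "\<dots> = (\<integral>\<^sup>+x\<in>\<Omega>. ennreal (P x y) \<partial>M) + (\<integral>\<^sup>+x\<in>X - \<Omega>. ennreal (P x y) \<partial>M)"
        by (rule nn_integral_add) measurable
      finally show "(\<integral>\<^sup>+x. ennreal (P x y) \<partial>M) * indicator \<Omega> y
        = (\<integral>\<^sup>+x\<in>\<Omega>. ennreal (P x y) \<partial>M) * indicator \<Omega> y
          + (\<integral>\<^sup>+x\<in>X - \<Omega>. ennreal (P x y) \<partial>M) * indicator \<Omega> y"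
        by (simp add: distrib_right)
    qed
    also have "\<dots> = ?p1 + ?p2"
      by (rule nn_integral_add) measurable
    finally show ?thesis .
  qed
  ultimately show ?thesis by (simp add: P_def N_def)
qed


section \<open>Lipschitz cutoffs and De Giorgi's iteration on a ball\<close>

definition cutoff :: "'a \<Rightarrow> real \<Rightarrow> real \<Rightarrow> 'a \<Rightarrow> real" where
  "cutoff z t \<delta> x = max 0 (min 1 ((t + \<delta> - d z x) / \<delta>))"

lemma cutoff_bounds: "0 \<le> cutoff z t \<delta> x" "cutoff z t \<delta> x \<le> 1"
  by (auto simp: cutoff_def)

lemma cutoff_eq_1: "0 < \<delta> \<Longrightarrow> d z x \<le> t \<Longrightarrow> cutoff z t \<delta> x = 1"
  by (simp add: cutoff_def field_simps)

lemma cutoff_eq_0: "0 < \<delta> \<Longrightarrow> z \<in> X \<Longrightarrow> x \<in> X - mball z (t + \<delta>) \<Longrightarrow> cutoff z t \<delta> x = 0"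
  by (auto simp: cutoff_def max_def min_def field_simps)

lemma cutoff_lipschitz:
  assumes "0 < \<delta>" "z \<in> X" "x \<in> X" "y \<in> X"
  shows "\<bar>cutoff z t \<delta> x - cutoff z t \<delta> y\<bar> \<le> d x y / \<delta>"
proof -
  have "\<bar>d z x - d z y\<bar> \<le> d x y"
    using triangle[of z x y] triangle[of z y x] assms by (auto simp: commute abs_le_iff)
  then have "\<bar>d z x - d z y\<bar> / \<delta> \<le> d x y / \<delta>"
    using assms by (intro divide_right_mono) auto
  moreover have "\<bar>cutoff z t \<delta> x - cutoff z t \<delta> y\<bar>
      \<le> \<bar>(t + \<delta> - d z x) / \<delta> - (t + \<delta> - d z y) / \<delta>\<bar>"
    unfolding cutoff_def by linarith
  moreover have "(t + \<delta> - d z x) / \<delta> - (t + \<delta> - d z y) / \<delta> = - ((d z x - d z y) / \<delta>)"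
    by (simp add: diff_divide_distrib add_divide_distrib)
  ultimately show ?thesis using assms by (simp add: abs_divide)
qed

lemma measurable_cutoff: "z \<in> X \<Longrightarrow> cutoff z t \<delta> \<in> borel_measurable M"
  unfolding cutoff_def[abs_def] by measurable

text \<open>By \<open>small\<close>, at least half of \<open>mball y r\<close> belongs to the zero
  set of \<open>w\<close>, so integrating the kernel over that set recovers \<open>w y\<close> up to
  the factor \<open>2 * Cmu * r powr s\<close>. The cutoff inequality bounds the same quantity from
  above. The constant \<open>12\<close> is this \<open>2\<close>, times \<open>3\<close> from
  \<open>subminimizer_cutoff\<close>, times \<open>2\<close> from
  \<open>nn_integral_cutoff_error\<close>.\<close>

lemma subminimizer_level_step:
  assumes \<Omega>: "openin mtopology \<Omega>" and u: "subminimizer s \<Omega> u" and s: "0 < s" "s < 1"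
    and z: "z \<in> X" and \<delta>: "0 < \<delta>" and sub: "mball z (t + \<delta>) \<subseteq> \<Omega>" and r: "0 < r"
    and w_def: "\<And>x. w x = max (real_of_ereal (u x) - k) 0"
    and w: "(\<integral>\<^sup>+x\<in>mball z (t + \<delta>). ennreal (w x) \<partial>M) < \<infinity>"
    and small: "\<And>y. y \<in> mball z t \<Longrightarrow>
      2 * measure M ({x \<in> X. 0 < w x} \<inter> mball y r) \<le> vol y r"
  shows "(\<integral>\<^sup>+x\<in>mball z t. ennreal (w x) \<partial>M)
    \<le> ennreal (12 * Cmu * kernel_const s Cmu * (r / \<delta>) powr s)
       * (\<integral>\<^sup>+x\<in>mball z (t + \<delta>). ennreal (w x) \<partial>M)"
proof -
  let ?\<phi> = "cutoff z t \<delta>" and ?B = "mball z (t + \<delta>)"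
  let ?I = "\<integral>\<^sup>+x\<in>?B. ennreal (w x) \<partial>M"
  let ?E = "{x \<in> X. 0 < w x}"
  have [measurable]: "u \<in> borel_measurable M"
    using u by (simp add: subminimizer_def)
  have w_meas [measurable]: "w \<in> borel_measurable M"
    unfolding w_def[abs_def] by measurable
  have E [measurable]: "?E \<in> sets M"
  proof -
    have "{x \<in> space M. 0 < w x} \<in> sets M" by measurable
    then show ?thesis by simp
  qed
  have w0: "0 \<le> w x" for x by (simp add: w_def)
  have K0: "0 \<le> kernel_const s Cmu"
    using s powr_less_mono[of "s - 1" 0 2] powr_less_mono[of "-s" 0 2] by (simp add: kernel_const_def)
  have err: "(\<integral>\<^sup>+y. \<integral>\<^sup>+x. ennreal (cutoff_error s ?B ?\<phi> w x y) \<partial>M \<partial>M)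
      \<le> ennreal (2 * kernel_const s Cmu / \<delta> powr s) * ?I"
    using cutoff_lipschitz \<delta> z s w0
    by (intro nn_integral_cutoff_error) (auto intro: cutoff_bounds measurable_cutoff)
  also have "\<dots> < \<infinity>" using w by (simp add: ennreal_mult_less_top)
  finally have "(\<integral>\<^sup>+y\<in>\<Omega>. (\<integral>\<^sup>+x. ennreal ((if w x = 0 then ?\<phi> y * w y else 0) * kern s x y) \<partial>M) \<partial>M)
     \<le> 3 * (\<integral>\<^sup>+y. \<integral>\<^sup>+x. ennreal (cutoff_error s ?B ?\<phi> w x y) \<partial>M \<partial>M)"
    using sub z \<delta> w
    by (intro subminimizer_cutoff[OF \<Omega> u _ _ _ _ _ _ w_def])
      (auto intro: cutoff_bounds measurable_cutoff cutoff_eq_0)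
  also have "\<dots> \<le> 3 * (ennreal (2 * kernel_const s Cmu / \<delta> powr s) * ?I)"
    using err by (intro mult_left_mono) auto
  finally have upper: "(\<integral>\<^sup>+y\<in>\<Omega>. (\<integral>\<^sup>+x. ennreal ((if w x = 0 then ?\<phi> y * w y else 0) * kern s x y) \<partial>M) \<partial>M)
     \<le> 3 * (ennreal (2 * kernel_const s Cmu / \<delta> powr s) * ?I)" .
  have lower: "ennreal (w y) \<le> ennreal (2 * Cmu * r powr s)
      * (\<integral>\<^sup>+x. ennreal ((if w x = 0 then ?\<phi> y * w y else 0) * kern s x y) \<partial>M)" if y: "y \<in> mball z t" for y
  proof (cases "w y = 0")
    case False
    have yX: "y \<in> X" using y by auto
    have \<phi>: "?\<phi> y = 1" using y \<delta> by (intro cutoff_eq_1) auto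
    \<comment> \<open>The value \<open>w y\<close> times the bound of \<open>kern_ge\<close>, whose
      condition \<open>x \<noteq> y\<close> holds because \<open>w x = 0\<close> while
      \<open>w y\<close> is not.\<close>
    let ?a = "w y * (1 / (Cmu * vol y r * r powr s))"
    have "ennreal (?a * (vol y r / 2)) \<le> ennreal (?a * measure M (mball y r - ?E))"
    proof (intro ennreal_leI mult_left_mono)
      have "measure M (mball y r - ?E) = vol y r - measure M (?E \<inter> mball y r)"
      proof -
        have "mball y r - ?E = mball y r - ?E \<inter> mball y r" by auto
        then show ?thesis
          unfolding vol_def using emeasure_mball_finite[OF yX, of r] E
          by (simp only:) (intro measure_Diff; auto)
      qed
      then show "vol y r / 2 \<le> measure M (mball y r - ?E)" using small[OF y] by simp
    qed (use w0 Cmu_pos vol_pos[OF yX r] in auto)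
    also have "\<dots> = ennreal ?a * emeasure M (mball y r - ?E)"
    proof -
      have "emeasure M (mball y r - ?E) \<le> emeasure M (mball y r)"
        by (intro emeasure_mono) auto
      then have "emeasure M (mball y r - ?E) = ennreal (measure M (mball y r - ?E))"
        using emeasure_mball_finite[OF yX, of r] by (intro emeasure_eq_ennreal_measure) auto
      then show ?thesis
        using w0 Cmu_pos vol_pos[OF yX r] by (simp add: ennreal_mult[symmetric])
    qed
    also have "\<dots> = (\<integral>\<^sup>+x. ennreal ?a * indicator (mball y r - ?E) x \<partial>M)"
      by (rule nn_integral_cmult_indicator[symmetric]) simp
    also have "\<dots> \<le> (\<integral>\<^sup>+x. ennreal ((if w x = 0 then ?\<phi> y * w y else 0) * kern s x y) \<partial>M)"
    proof (rule nn_integral_mono)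
      fix x assume x: "x \<in> space M"
      show "ennreal ?a * indicator (mball y r - ?E) x
          \<le> ennreal ((if w x = 0 then ?\<phi> y * w y else 0) * kern s x y)"
      proof (cases "x \<in> mball y r - ?E")
        case True
        then have wx: "w x = 0" using w0[of x] by auto
        have "1 / (Cmu * vol y r * r powr s) \<le> kern s x y"
          using True False wx s by (intro kern_ge) (auto simp: commute)
        then have "?a \<le> w y * kern s x y"
          using w0 by (rule mult_left_mono)
        then show ?thesis
          using True wx \<phi> by (simp add: ennreal_leI)
      qed simp
    qed
    finally have "ennreal (2 * Cmu * r powr s) * ennreal (?a * (vol y r / 2))
      \<le> ennreal (2 * Cmu * r powr s)
        * (\<integral>\<^sup>+x. ennreal ((if w x = 0 then ?\<phi> y * w y else 0) * kern s x y) \<partial>M)"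
      by (intro mult_left_mono) auto
    moreover have "ennreal (2 * Cmu * r powr s) * ennreal (?a * (vol y r / 2)) = ennreal (w y)"
      using Cmu_pos vol_pos[OF yX r] r w0[of y] by (subst ennreal_mult[symmetric]) auto
    ultimately show ?thesis by simp
  qed simp
  have "(\<integral>\<^sup>+x\<in>mball z t. ennreal (w x) \<partial>M) \<le> (\<integral>\<^sup>+y. ennreal (2 * Cmu * r powr s) *
      ((\<integral>\<^sup>+x. ennreal ((if w x = 0 then ?\<phi> y * w y else 0) * kern s x y) \<partial>M) * indicator \<Omega> y) \<partial>M)"
  proof (rule nn_integral_mono)
    fix y
    have "mball z t \<subseteq> \<Omega>"
      using sub mball_subset_concentric[of t "t + \<delta>" z] \<delta> by auto
    then show "ennreal (w y) * indicator (mball z t) y \<le> ennreal (2 * Cmu * r powr s) *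
      ((\<integral>\<^sup>+x. ennreal ((if w x = 0 then ?\<phi> y * w y else 0) * kern s x y) \<partial>M) * indicator \<Omega> y)"
      using lower[of y] by (cases "y \<in> mball z t") auto
  qed
  also have "\<dots> = ennreal (2 * Cmu * r powr s) *
      (\<integral>\<^sup>+y\<in>\<Omega>. (\<integral>\<^sup>+x. ennreal ((if w x = 0 then ?\<phi> y * w y else 0) * kern s x y) \<partial>M) \<partial>M)"
  proof (rule nn_integral_cmult)
    have [measurable]: "\<Omega> \<in> sets M" "?\<phi> \<in> borel_measurable M"
      using \<Omega> z by (auto intro: openin_sets_M measurable_cutoff)
    show "(\<lambda>y. (\<integral>\<^sup>+x. ennreal ((if w x = 0 then ?\<phi> y * w y else 0) * kern s x y) \<partial>M) * indicator \<Omega> y)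
        \<in> borel_measurable M"
      by measurable
  qed
  also have "\<dots> \<le> ennreal (2 * Cmu * r powr s) * (3 * (ennreal (2 * kernel_const s Cmu / \<delta> powr s) * ?I))"
    using upper by (rule mult_left_mono) simp
  also have "\<dots> = (ennreal (2 * Cmu * r powr s) * 3 * ennreal (2 * kernel_const s Cmu / \<delta> powr s)) * ?I"
    by (simp add: mult.assoc)
  also have "ennreal (2 * Cmu * r powr s) * 3 * ennreal (2 * kernel_const s Cmu / \<delta> powr s)
      = ennreal (2 * Cmu * r powr s * 3 * (2 * kernel_const s Cmu / \<delta> powr s))"
  proof -
    have "ennreal a * 3 * ennreal b = ennreal (a * 3 * b)" if "0 \<le> a" "0 \<le> b" for a b
      using that by (simp add: ennreal_mult)
    then show ?thesis using K0 Cmu_pos by simp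
  qed
  also have "2 * Cmu * r powr s * 3 * (2 * kernel_const s Cmu / \<delta> powr s)
      = 12 * Cmu * kernel_const s Cmu * (r / \<delta>) powr s"
    using r \<delta> by (simp add: powr_divide)
  finally show ?thesis .
qed

text \<open>The recursion is linear, with a fixed factor \<open>\<theta>\<close>, rather than
  superlinear. A step is possible when the positivity set fills at most half of every small ball,
  and the decay reached so far guarantees this by Chebyshev's inequality. Assumption
  \<open>m\<close> fixes the ratio \<open>r / \<delta> = 1 / 2 ^ m\<close> for which a step
  contracts by \<open>\<theta>\<close>; \<open>I0\<close> supplies the smallness for the density
  condition.\<close>

lemma subminimizer_local_bound:
  assumes \<Omega>: "openin mtopology \<Omega>" and u: "subminimizer s \<Omega> u" and s: "0 < s" "s < 1"
    and z: "z \<in> X" and \<rho>: "0 < \<rho>" and sub: "mball z \<rho> \<subseteq> \<Omega>" and k: "0 < k"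
    and m: "12 * Cmu * kernel_const s Cmu * (1 / 2 ^ m) powr s \<le> 1 / (2 * Cmu)"
    and I0: "ennreal (4 * Cmu ^ (m + 3)) * (\<integral>\<^sup>+x\<in>mball z \<rho>. ennreal (max (real_of_ereal (u x) - k\<^sub>0) 0) \<partial>M)
      \<le> ennreal (k * vol z \<rho>)"
  shows "AE x in M. x \<in> mball z (\<rho> / 2) \<longrightarrow> real_of_ereal (u x) \<le> k\<^sub>0 + k"
proof -
  define U where "U x = real_of_ereal (u x)" for x
  define t where "t j = \<rho> / 2 * (1 + 1 / 2 ^ j)" for j :: nat
  define \<kappa> where "\<kappa> j = k\<^sub>0 + k * (1 - 1 / 2 ^ j)" for j :: nat
  define w where "w j x = max (U x - \<kappa> j) 0" for j x
  define I where "I j = (\<integral>\<^sup>+x\<in>mball z (t j). ennreal (w j x) \<partial>M)" for j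
  \<comment> \<open>The \<open>2\<close> pays for the halving of the level gaps and
    \<open>Cmu\<close> for the halving of the radii, so the density estimate is the same at every
    stage.\<close>
  define \<theta> where "\<theta> = 1 / (2 * Cmu)"
  have [measurable]: "u \<in> borel_measurable M"
    using u by (simp add: subminimizer_def)
  have [measurable]: "U \<in> borel_measurable M"
    unfolding U_def[abs_def] by measurable
  have [measurable]: "w j \<in> borel_measurable M" for j
    unfolding w_def[abs_def] by measurable
  have \<theta>: "0 < \<theta>" "\<theta> \<le> 1 / 2"
    using Cmu_ge_1 by (auto simp: \<theta>_def field_simps)
  have I0': "ennreal (4 * Cmu ^ (m + 3)) * I 0 \<le> ennreal (k * vol z \<rho>)"
    using I0 by (simp add: I_def w_def t_def \<kappa>_def U_def)
  have "I 0 \<noteq> top"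
  proof
    assume "I 0 = top"
    then have "ennreal (4 * Cmu ^ (m + 3)) * I 0 = top"
      using Cmu_pos by (simp add: ennreal_mult_top)
    with I0' show False by (simp add: top_unique)
  qed
  then obtain i where i: "I 0 = ennreal i" "0 \<le> i" by (cases "I 0") auto
  have i_le: "4 * Cmu ^ (m + 3) * i \<le> k * vol z \<rho>"
  proof -
    have "ennreal (4 * Cmu ^ (m + 3) * i) \<le> ennreal (k * vol z \<rho>)"
      using I0' i Cmu_pos by (simp add: ennreal_mult)
    moreover have "0 \<le> k * vol z \<rho>" using k vol_pos[OF z \<rho>] by simp
    ultimately show ?thesis by (simp add: ennreal_le_iff)
  qed
  have t_le: "t j \<le> \<rho>" for j
    using \<rho> by (simp add: t_def field_simps)
  have decay: "I j \<le> ennreal (\<theta> ^ j * i)" for j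
  proof (induction j)
    case (Suc j)
    \<comment> \<open>Exactly the gap \<open>t j - t (Suc j)\<close>.\<close>
    define \<delta> where "\<delta> = \<rho> / 2 ^ (j + 2)"
    define r where "r = \<delta> / 2 ^ m"
    have \<delta>: "0 < \<delta>" and r: "0 < r" "r \<le> \<delta>"
      using \<rho> by (auto simp: \<delta>_def r_def field_simps)
    have t: "t (Suc j) + \<delta> = t j"
      by (simp add: t_def \<delta>_def field_simps)
    have mono: "(\<integral>\<^sup>+x\<in>mball z (t j). ennreal (w (Suc j) x) \<partial>M) \<le> I j"
      unfolding I_def
    proof (intro nn_integral_mono mult_right_mono ennreal_leI)
      fix x
      have "k * (1 - 1 / 2 ^ j) \<le> k * (1 - 1 / 2 ^ Suc j)"
        using k by (intro mult_left_mono diff_left_mono divide_left_mono power_increasing) auto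
      then show "w (Suc j) x \<le> w j x" by (simp add: w_def \<kappa>_def)
    qed simp
    have fin: "(\<integral>\<^sup>+x\<in>mball z (t j). ennreal (w (Suc j) x) \<partial>M) < \<infinity>"
      using mono Suc by (auto simp: less_top[symmetric] top_unique)
    have "(\<integral>\<^sup>+x\<in>mball z (t (Suc j)). ennreal (w (Suc j) x) \<partial>M)
      \<le> ennreal (12 * Cmu * kernel_const s Cmu * (r / \<delta>) powr s)
        * (\<integral>\<^sup>+x\<in>mball z (t (Suc j) + \<delta>). ennreal (w (Suc j) x) \<partial>M)"
    proof (rule subminimizer_level_step[OF \<Omega> u s z \<delta> _ r(1), where k = "\<kappa> (Suc j)"])
      show "mball z (t (Suc j) + \<delta>) \<subseteq> \<Omega>"
        unfolding t using sub mball_subset_concentric[OF t_le] by blast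
      show "w (Suc j) x = max (real_of_ereal (u x) - \<kappa> (Suc j)) 0" for x
        by (simp add: w_def U_def)
      show "(\<integral>\<^sup>+x\<in>mball z (t (Suc j) + \<delta>). ennreal (w (Suc j) x) \<partial>M) < \<infinity>"
        unfolding t by (rule fin)
      fix y assume y: "y \<in> mball z (t (Suc j))"
      then have yX: "y \<in> X" by auto
      let ?E = "{x \<in> X. 0 < w (Suc j) x}"
      have E [measurable]: "?E \<in> sets M"
      proof -
        have "{x \<in> space M. 0 < w (Suc j) x} \<in> sets M" by measurable
        then show ?thesis by simp
      qed
      let ?e = "measure M (?E \<inter> mball z (t j))"
      have "emeasure M (?E \<inter> mball z (t j)) \<le> emeasure M (mball z (t j))"
        by (intro emeasure_mono) auto
      then have Efin: "emeasure M (?E \<inter> mball z (t j)) < \<infinity>"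
        using emeasure_mball_finite[OF z, of "t j"] by order
      then have Eeq: "emeasure M (?E \<inter> mball z (t j)) = ennreal ?e"
        by (intro emeasure_eq_ennreal_measure) auto
      have "mball y r \<subseteq> mball z (t j)"
      proof
        fix x assume "x \<in> mball y r"
        moreover have "d z x \<le> d z y + d y x" using y z \<open>x \<in> mball y r\<close> by (intro triangle) auto
        ultimately show "x \<in> mball z (t j)" using y z r(2) t by auto
      qed
      then have le_e: "measure M (?E \<inter> mball y r) \<le> ?e"
        using Efin by (intro measure_mono_fmeasurable) (auto simp: fmeasurable_def)
      \<comment> \<open>Chebyshev's inequality: above the level \<open>\<kappa> (Suc j)\<close> the
        function \<open>w j\<close> is at least the level gap \<open>k / 2 ^ Suc j\<close>.\<close>
      have "ennreal (k / 2 ^ Suc j * ?e) = ennreal (k / 2 ^ Suc j) * emeasure M (?E \<inter> mball z (t j))"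
        unfolding Eeq using k by (intro ennreal_mult) auto
      also have "\<dots> = (\<integral>\<^sup>+x. ennreal (k / 2 ^ Suc j) * indicator (?E \<inter> mball z (t j)) x \<partial>M)"
        by (rule nn_integral_cmult_indicator[symmetric]) simp
      also have "\<dots> \<le> I j"
        unfolding I_def
      proof (rule nn_integral_mono)
        fix x
        show "ennreal (k / 2 ^ Suc j) * indicator (?E \<inter> mball z (t j)) x
            \<le> ennreal (w j x) * indicator (mball z (t j)) x"
        proof (cases "x \<in> ?E \<inter> mball z (t j)")
          case True
          then have "\<kappa> (Suc j) < U x" by (auto simp: w_def)
          moreover have "\<kappa> (Suc j) - \<kappa> j = k / 2 ^ Suc j" by (simp add: \<kappa>_def field_simps)
          ultimately have "k / 2 ^ Suc j \<le> w j x" by (simp add: w_def)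
          then show ?thesis using True by (simp add: ennreal_leI)
        qed simp
      qed
      also note Suc
      finally have "k / 2 ^ Suc j * ?e \<le> \<theta> ^ j * i"
        using i \<theta> by (subst (asm) ennreal_le_iff) auto
      then have "4 * Cmu ^ (m + 3) * (k / 2 ^ Suc j * ?e) \<le> 4 * Cmu ^ (m + 3) * (\<theta> ^ j * i)"
        using Cmu_pos by (intro mult_left_mono) auto
      also have "\<dots> = \<theta> ^ j * (4 * Cmu ^ (m + 3) * i)" by simp
      also have "\<dots> \<le> \<theta> ^ j * (k * vol z \<rho>)"
        using i_le \<theta> by (intro mult_left_mono) auto
      finally have "k * (4 * Cmu ^ (m + 3) / 2 ^ Suc j * ?e) \<le> k * (\<theta> ^ j * vol z \<rho>)"
        by (simp add: mult_ac)
      then have "4 * Cmu ^ (m + 3) / 2 ^ Suc j * ?e \<le> \<theta> ^ j * vol z \<rho>"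
        using k by (rule mult_left_le_imp_le)
      \<comment> \<open>Multiplying by \<open>(2 * Cmu) ^ j\<close> removes
        \<open>\<theta> ^ j\<close> and gives the power of \<open>Cmu\<close> for the
        \<open>j + m + 3\<close> doublings from \<open>r\<close> to \<open>2 * \<rho>\<close>, one
        of which allows for the change of centre from \<open>z\<close> to \<open>y\<close>.\<close>
      then have "2 * Cmu ^ (j + m + 3) * ?e \<le> vol z \<rho>"
        using Cmu_pos by (simp add: \<theta>_def power_divide power_mult_distrib power_add field_simps)
      also have "vol z \<rho> \<le> vol y (2 * \<rho>)"
      proof (intro vol_mono yX subsetI)
        fix x assume x: "x \<in> mball z \<rho>"
        have "d y x \<le> d y z + d z x" using x yX z by (intro triangle) auto
        moreover have "d y z < \<rho>" using y t_le[of "Suc j"] by (auto simp: commute)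
        ultimately show "x \<in> mball y (2 * \<rho>)" using x yX by auto
      qed
      also have "2 * \<rho> = 2 ^ (j + m + 3) * r"
        by (simp add: r_def \<delta>_def power_add)
      also have "vol y (2 ^ (j + m + 3) * r) \<le> Cmu ^ (j + m + 3) * vol y r"
        using yX r by (intro vol_double_power)
      finally have "Cmu ^ (j + m + 3) * (2 * ?e) \<le> Cmu ^ (j + m + 3) * vol y r"
        by (simp add: mult_ac)
      then have "2 * ?e \<le> vol y r"
        by (rule mult_left_le_imp_le) (use Cmu_pos in simp)
      then show "2 * measure M (?E \<inter> mball y r) \<le> vol y r" using le_e by linarith
    qed
    also have "\<dots> \<le> ennreal \<theta> * I j"
      unfolding t
    proof (intro mult_mono mono ennreal_leI)
      have "r / \<delta> = 1 / 2 ^ m" using \<delta> by (simp add: r_def)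
      then show "12 * Cmu * kernel_const s Cmu * (r / \<delta>) powr s \<le> \<theta>"
        using m by (simp add: \<theta>_def)
    qed auto
    also have "\<dots> \<le> ennreal \<theta> * ennreal (\<theta> ^ j * i)"
      using Suc by (intro mult_left_mono) auto
    also have "\<dots> = ennreal (\<theta> ^ Suc j * i)"
      using \<theta> i by (simp add: ennreal_mult[symmetric] mult.assoc)
    finally show ?case by (simp add: I_def)
  qed (use i in simp)
  \<comment> \<open>\<open>ennreal\<close> truncates negative arguments, so this integrates the
    positive part above the limiting level. It lies below every \<open>I j\<close>, and the decay
    forces it to vanish.\<close>
  let ?J = "\<integral>\<^sup>+x\<in>mball z (\<rho> / 2). ennreal (U x - (k\<^sub>0 + k)) \<partial>M"
  have J: "?J \<le> ennreal (\<theta> ^ j * i)" for j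
  proof -
    have "?J \<le> I j"
      unfolding I_def
    proof (rule nn_integral_mono)
      fix x
      have "U x - (k\<^sub>0 + k) \<le> w j x"
      proof -
        have "k * (1 - 1 / 2 ^ j) \<le> k" using k by (intro mult_left_le) auto
        then show ?thesis by (simp add: w_def \<kappa>_def)
      qed
      moreover have "\<rho> / 2 \<le> t j" using \<rho> by (simp add: t_def field_simps)
      ultimately show "ennreal (U x - (k\<^sub>0 + k)) * indicator (mball z (\<rho> / 2)) x
          \<le> ennreal (w j x) * indicator (mball z (t j)) x"
        by (auto simp: indicator_def intro: ennreal_leI)
    qed
    with decay[of j] show ?thesis by (rule order_trans[rotated])
  qed
  have "?J = 0"
  proof -
    have "(\<lambda>j. ennreal (\<theta> ^ j * i)) \<longlonglongrightarrow> ennreal (0 * i)"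
      using \<theta> by (intro tendsto_ennrealI tendsto_mult LIMSEQ_power_zero tendsto_const) auto
    then have "?J \<le> ennreal (0 * i)"
      using J by (intro LIMSEQ_le_const) auto
    then show ?thesis by simp
  qed
  then have "AE x in M. ennreal (U x - (k\<^sub>0 + k)) * indicator (mball z (\<rho> / 2)) x = 0"
    by (subst (asm) nn_integral_0_iff_AE) auto
  then show ?thesis
    by eventually_elim (auto simp: U_def indicator_def ennreal_eq_0_iff split: if_splits)
qed


section \<open>Covering by smaller balls and the doubling dimension\<close>

lemma doubling_dimension_vol:
  assumes Q: "doubling_dimension c Q" and x: "x \<in> X" and r: "0 < r" "r < R"
  shows "c * (r / R) powr Q * vol x R \<le> vol x r"
proof -
  have "ennreal (c * (r / R) powr Q) \<le> mu (mball x r) / mu (mball x R)"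
    using Q x r by (auto simp: doubling_dimension_def)
  also have "\<dots> = ennreal (vol x r / vol x R)"
    using vol_pos[OF x, of r] vol_pos[OF x, of R] r x
    by (simp add: emeasure_M[symmetric] emeasure_mball divide_ennreal)
  finally have "c * (r / R) powr Q \<le> vol x r / vol x R"
    using vol_pos[OF x, of r] vol_pos[OF x, of R] r by (subst (asm) ennreal_le_iff) auto
  then show ?thesis
    using vol_pos[OF x, of R] r by (simp add: pos_le_divide_eq)
qed

text \<open>Balls of radius \<open>R - r\<close> centred in \<open>mball x\<^sub>0 r\<close> stay in
  \<open>mball x\<^sub>0 R\<close>, and countably many of the concentric balls of half that radius
  cover \<open>mball x\<^sub>0 r\<close>. The doubling dimension bounds their volumes from below by
  that of the large ball, which produces the power of \<open>R / (R - r)\<close>.\<close>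

lemma subminimizer_ess_sup_le:
  assumes \<Omega>: "openin mtopology \<Omega>" and u: "subminimizer s \<Omega> u" and s: "0 < s" "s < 1"
    and Q: "doubling_dimension c Q" and x0: "x\<^sub>0 \<in> \<Omega>"
    and r: "0 < r" "r < R" and sub: "mball x\<^sub>0 R \<subseteq> \<Omega>"
    and m: "12 * Cmu * kernel_const s Cmu * (1 / 2 ^ m) powr s \<le> 1 / (2 * Cmu)"
  shows "ess_sup_on (mball x\<^sub>0 r) (\<lambda>y. u y - ereal k\<^sub>0)
    \<le> ereal (4 * Cmu ^ (m + 4) / c * (R / (R - r)) powr Q)
      * average (mball x\<^sub>0 R) (\<lambda>y. max (u y - ereal k\<^sub>0) 0)"
proof -
  define \<rho> where "\<rho> = R - r"
  \<comment> \<open>The constant \<open>4 * Cmu ^ (m + 3)\<close> of the local bound, one more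
    \<open>Cmu\<close> for moving the centre of the large ball, and \<open>1 / c\<close> with the
    power from the doubling dimension.\<close>
  define T where "T = 4 * Cmu ^ (m + 4) / c * (R / (R - r)) powr Q"
  define I where "I = (\<integral>\<^sup>+x\<in>mball x\<^sub>0 R. e2ennreal (max (u x - ereal k\<^sub>0) 0) \<partial>M)"
  have c: "0 < c" using Q by (simp add: doubling_dimension_def)
  have X0: "x\<^sub>0 \<in> X" using x0 \<Omega> openin_subset[of mtopology \<Omega>] by auto
  have u_meas [measurable]: "u \<in> borel_measurable M" and sem: "W_seminorm s \<Omega> u < \<infinity>"
    using u by (auto simp: subminimizer_def W_dot_def)
  have fin: "AE x in M. x \<in> \<Omega> \<longrightarrow> \<bar>u x\<bar> \<noteq> \<infinity>"
    by (rule AE_finite_of_W_dot[OF \<Omega> u_meas sem])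
  have \<rho>: "0 < \<rho>" "\<rho> < R" using r by (auto simp: \<rho>_def)
  have T: "0 < T" using c Cmu_pos r by (simp add: T_def)
  have avg: "average (mball x\<^sub>0 R) (\<lambda>y. max (u y - ereal k\<^sub>0) 0) = enn2ereal I / ereal (vol x\<^sub>0 R)"
  proof -
    have "e2ennreal (- max (u x - ereal k\<^sub>0) 0) = 0" for x
      by (rule e2ennreal_neg) simp
    then show ?thesis
      using X0 vol_pos[OF X0, of R] r
      by (simp add: zero_ennreal.rep_eq average_def signed_integral_def I_def emeasure_M[symmetric] emeasure_mball)
  qed
  show ?thesis
  proof (cases "I = top")
    case True
    then have "average (mball x\<^sub>0 R) (\<lambda>y. max (u y - ereal k\<^sub>0) 0) = \<infinity>"
      using vol_pos[OF X0, of R] r by (simp add: avg)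
    then show ?thesis unfolding T_def[symmetric] using T by simp
  next
    case False
    then obtain i where i: "I = ennreal i" "0 \<le> i" by (cases I) auto
    have rhs: "ereal T * average (mball x\<^sub>0 R) (\<lambda>y. max (u y - ereal k\<^sub>0) 0) = ereal (T * (i / vol x\<^sub>0 R))"
      using vol_pos[OF X0, of R] r i by (simp add: avg)
    \<comment> \<open>The strict inequality keeps \<open>k\<close> positive even when the average
      vanishes, as the local bound requires; letting \<open>k\<close> decrease then gives the
      claim.\<close>
    have le: "ess_sup_on (mball x\<^sub>0 r) (\<lambda>y. u y - ereal k\<^sub>0) \<le> ereal k" if k: "T * (i / vol x\<^sub>0 R) < k" for k
    proof -
      have "0 \<le> T * (i / vol x\<^sub>0 R)" using T i vol_pos[OF X0, of R] r by simp
      with k have k0: "0 < k" by linarith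
      obtain D where D: "countable D" "D \<subseteq> X" "\<And>x e. x \<in> X \<Longrightarrow> 0 < e \<Longrightarrow> \<exists>q\<in>D. d x q < e"
        by (rule countable_dense) blast
      have "AE x in M. \<forall>q \<in> D \<inter> mball x\<^sub>0 r. x \<in> mball q (\<rho> / 2) \<longrightarrow> real_of_ereal (u x) \<le> k\<^sub>0 + k"
      proof (subst AE_ball_countable)
        show "countable (D \<inter> mball x\<^sub>0 r)" using D(1) by auto
        show "\<forall>q \<in> D \<inter> mball x\<^sub>0 r. AE x in M. x \<in> mball q (\<rho> / 2) \<longrightarrow> real_of_ereal (u x) \<le> k\<^sub>0 + k"
        proof
          fix q assume q: "q \<in> D \<inter> mball x\<^sub>0 r"
          then have qX: "q \<in> X" by auto
          have subR: "mball q \<rho> \<subseteq> mball x\<^sub>0 R"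
          proof
            fix x assume x: "x \<in> mball q \<rho>"
            have "d x\<^sub>0 x \<le> d x\<^sub>0 q + d q x" using x qX X0 by (intro triangle) auto
            then show "x \<in> mball x\<^sub>0 R" using x q by (auto simp: \<rho>_def)
          qed
          have "mball x\<^sub>0 R \<subseteq> mball q (2 * R)"
          proof
            fix x assume x: "x \<in> mball x\<^sub>0 R"
            have "d q x \<le> d q x\<^sub>0 + d x\<^sub>0 x" using x qX X0 by (intro triangle) auto
            then show "x \<in> mball q (2 * R)" using x q r by (auto simp: commute)
          qed
          then have "vol x\<^sub>0 R \<le> vol q (2 * R)" using qX by (rule vol_mono)
          also have "\<dots> \<le> Cmu * vol q R" using qX r by (intro vol_double) auto
          finally have v1: "vol x\<^sub>0 R \<le> Cmu * vol q R" .
          have v2: "c * (\<rho> / R) powr Q * vol q R \<le> vol q \<rho>"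
            using Q qX \<rho> by (rule doubling_dimension_vol)
          have "c * (\<rho> / R) powr Q * vol x\<^sub>0 R \<le> c * (\<rho> / R) powr Q * (Cmu * vol q R)"
            using v1 c by (intro mult_left_mono) auto
          also have "\<dots> \<le> Cmu * vol q \<rho>"
            using mult_left_mono[OF v2, of Cmu] Cmu_pos by (simp add: mult_ac)
          finally have v: "c * (\<rho> / R) powr Q * vol x\<^sub>0 R \<le> Cmu * vol q \<rho>" .
          show "AE x in M. x \<in> mball q (\<rho> / 2) \<longrightarrow> real_of_ereal (u x) \<le> k\<^sub>0 + k"
          proof (rule subminimizer_local_bound[OF \<Omega> u s qX \<rho>(1) _ k0 m])
            show "mball q \<rho> \<subseteq> \<Omega>" using subR sub by auto
            have "(\<integral>\<^sup>+x\<in>mball q \<rho>. ennreal (max (real_of_ereal (u x) - k\<^sub>0) 0) \<partial>M) \<le> I"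
              unfolding I_def
            proof (rule nn_integral_mono_AE)
              show "AE x in M. ennreal (max (real_of_ereal (u x) - k\<^sub>0) 0) * indicator (mball q \<rho>) x
                \<le> e2ennreal (max (u x - ereal k\<^sub>0) 0) * indicator (mball x\<^sub>0 R) x"
                using fin
              proof eventually_elim
                case (elim x)
                show ?case
                proof (cases "x \<in> mball q \<rho>")
                  case True
                  then have "x \<in> mball x\<^sub>0 R" "x \<in> \<Omega>" using subR sub by auto
                  moreover obtain a where "u x = ereal a" using elim \<open>x \<in> \<Omega>\<close> by auto
                  ultimately show ?thesis
                    using True by (simp add: zero_ereal_def ereal_max[symmetric] del: ereal_max)
                qed simp
              qed
            qed
            then have "ennreal (4 * Cmu ^ (m + 3))
                * (\<integral>\<^sup>+x\<in>mball q \<rho>. ennreal (max (real_of_ereal (u x) - k\<^sub>0) 0) \<partial>M)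
                \<le> ennreal (4 * Cmu ^ (m + 3)) * ennreal i"
              unfolding i(1) by (rule mult_left_mono) simp
            also have "\<dots> = ennreal (4 * Cmu ^ (m + 3) * i)"
              using i Cmu_pos by (intro ennreal_mult[symmetric]) auto
            also have "\<dots> \<le> ennreal (k * vol q \<rho>)"
            proof (rule ennreal_leI)
              have p: "(R / \<rho>) powr Q * (\<rho> / R) powr Q = 1"
                using \<rho> by (simp add: powr_mult[symmetric])
              have "Cmu * (4 * Cmu ^ (m + 3) * i)
                  = (4 * Cmu ^ (m + 4) / c * ((R / \<rho>) powr Q * (\<rho> / R) powr Q) * (i / vol x\<^sub>0 R)) * (c * vol x\<^sub>0 R)"
                unfolding p using c vol_pos[OF X0, of R] r by (simp add: power_add field_simps eval_nat_numeral)
              also have "\<dots> = (T * (i / vol x\<^sub>0 R)) * (c * (\<rho> / R) powr Q * vol x\<^sub>0 R)"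
                by (simp add: T_def \<rho>_def mult_ac)
              also have "\<dots> \<le> k * (c * (\<rho> / R) powr Q * vol x\<^sub>0 R)"
                using k c vol_pos[OF X0, of R] r by (intro mult_right_mono) auto
              also have "\<dots> \<le> k * (Cmu * vol q \<rho>)"
                using v k0 by (intro mult_left_mono) auto
              finally have "Cmu * (4 * Cmu ^ (m + 3) * i) \<le> Cmu * (k * vol q \<rho>)"
                by (simp add: mult_ac)
              then show "4 * Cmu ^ (m + 3) * i \<le> k * vol q \<rho>"
                using Cmu_pos by (rule mult_left_le_imp_le)
            qed
            finally show "ennreal (4 * Cmu ^ (m + 3))
                * (\<integral>\<^sup>+x\<in>mball q \<rho>. ennreal (max (real_of_ereal (u x) - k\<^sub>0) 0) \<partial>M) \<le> ennreal (k * vol q \<rho>)" .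
          qed
        qed
      qed
      with fin have ae: "AE x in M. x \<in> mball x\<^sub>0 r \<longrightarrow> u x - ereal k\<^sub>0 \<le> ereal k"
      proof eventually_elim
        case (elim x)
        show ?case
        proof
          assume x: "x \<in> mball x\<^sub>0 r"
          then have "x \<in> mball x\<^sub>0 R" using r by auto
          then have "x \<in> \<Omega>" using sub by auto
          \<comment> \<open>The first bound puts \<open>x\<close> into the half ball around
            \<open>q\<close>, the second keeps the centre \<open>q\<close> in
            \<open>mball x\<^sub>0 r\<close>.\<close>
          define e where "e = min (\<rho> / 2) (r - d x\<^sub>0 x)"
          have "0 < e" using x \<rho> by (auto simp: e_def)
          then obtain q where q: "q \<in> D" "d x q < e" using D(3)[of x e] x by auto
          have qX: "q \<in> X" using q D by auto
          have "d x\<^sub>0 q \<le> d x\<^sub>0 x + d x q" using x qX by (intro triangle) auto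
          then have "q \<in> D \<inter> mball x\<^sub>0 r" "x \<in> mball q (\<rho> / 2)"
            using q x qX by (auto simp: e_def commute)
          then have "real_of_ereal (u x) \<le> k\<^sub>0 + k" using elim by blast
          moreover obtain a where "u x = ereal a" using elim \<open>x \<in> \<Omega>\<close> by auto
          ultimately show "u x - ereal k\<^sub>0 \<le> ereal k" by simp
        qed
      qed
      show ?thesis
        unfolding ess_sup_on_def
      proof (rule esssup_I)
        show "(\<lambda>y. u y - ereal k\<^sub>0) \<in> borel_measurable (restrict_space M (mball x\<^sub>0 r))"
          by (intro measurable_restrict_space1) measurable
        show "AE y in restrict_space M (mball x\<^sub>0 r). u y - ereal k\<^sub>0 \<le> ereal k"
          using ae by (subst AE_restrict_space_iff[OF sets.Int[OF mball_sets sets.top]])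
      qed
    qed
    have "ess_sup_on (mball x\<^sub>0 r) (\<lambda>y. u y - ereal k\<^sub>0) \<le> ereal (T * (i / vol x\<^sub>0 R))"
    proof (rule ccontr)
      assume "\<not> ?thesis"
      then obtain k where "ereal (T * (i / vol x\<^sub>0 R)) < ereal k"
          "ereal k < ess_sup_on (mball x\<^sub>0 r) (\<lambda>y. u y - ereal k\<^sub>0)"
        using ereal_dense2 by (meson not_le)
      with le[of k] show False by auto
    qed
    then show ?thesis unfolding T_def[symmetric] rhs .
  qed
qed

end

section \<open>A constant uniform over all spaces\<close>

theorem theorem1p1:
  fixes s Cmu c :: real
  assumes "0 < s" and "s < 1"
  shows "\<exists>C>0. \<forall>(X :: 'a set) (d :: 'a \<Rightarrow> 'a \<Rightarrow> real) (mu :: 'a set \<Rightarrow> ennreal)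
      (Q :: real) (\<Omega> :: 'a set) (u :: 'a \<Rightarrow> ereal).
    metric_measure_space X d mu \<and>
    Metric_space.mcomplete X d \<and>
    connected_space (Metric_space.mtopology X d) \<and>
    metric_measure_space.doubling_measure X d mu Cmu \<and>
    metric_measure_space.doubling_dimension X d mu c Q \<and> Q > s \<and>
    openin (Metric_space.mtopology X d) \<Omega> \<and> \<Omega> \<noteq> {} \<and>
    metric_measure_space.subminimizer X d mu s \<Omega> u \<longrightarrow>
    (\<forall>(k\<^sub>0 :: real). \<forall>x\<^sub>0 \<in> \<Omega>. \<forall>(r :: real) (R :: real).
       0 < r \<and> r < R \<and> Metric_space.mball X d x\<^sub>0 R \<subseteq> \<Omega> \<longrightarrow>
       metric_measure_space.ess_sup_on X mu
           (Metric_space.mball X d x\<^sub>0 r) (\<lambda>y. u y - ereal k\<^sub>0)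
         \<le> ereal (C * (R / (R - r)) powr Q) *
           metric_measure_space.average X mu
             (Metric_space.mball X d x\<^sub>0 R) (\<lambda>y. max (u y - ereal k\<^sub>0) 0))"
proof (cases "0 < Cmu \<and> 0 < c")
  case True
  define K where "K = 12 * Cmu * kernel_const s Cmu"
  have "0 < kernel_const s Cmu"
    using True assms powr_less_mono[of "s - 1" 0 2] powr_less_mono[of "-s" 0 2]
    unfolding kernel_const_def by (intro mult_pos_pos add_pos_pos) auto
  then have K: "0 < K" using True by (simp add: K_def)
  have "2 powr (- s) < 1" using assms powr_less_mono[of "-s" 0 2] by simp
  \<comment> \<open>The powers tend to \<open>0\<close>, so some \<open>m\<close>, chosen from
    \<open>s\<close> and \<open>Cmu\<close> alone, makes the level step contract by
    \<open>1 / (2 * Cmu)\<close>.\<close>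
  then obtain m where "(2 powr (- s)) ^ m < 1 / (2 * Cmu) / K"
    using real_arch_pow_inv[of "1 / (2 * Cmu) / K" "2 powr (- s)"] True K by auto
  moreover have "(2 powr (- s)) ^ m = (1 / 2 ^ m) powr s"
    by (simp add: powr_minus_divide power_divide powr_divide powr_power powr_realpow[symmetric] powr_powr mult.commute)
  ultimately have m: "K * (1 / 2 ^ m) powr s \<le> 1 / (2 * Cmu)"
    using pos_less_divide_eq[OF K] by (metis less_imp_le mult.commute)
  have "metric_measure_space.ess_sup_on X mu (Metric_space.mball X d x\<^sub>0 r) (\<lambda>y. u y - ereal k\<^sub>0)
      \<le> ereal (4 * Cmu ^ (m + 4) / c * (R / (R - r)) powr Q) *
        metric_measure_space.average X mu
          (Metric_space.mball X d x\<^sub>0 R) (\<lambda>y. max (u y - ereal k\<^sub>0) 0)"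
    if "metric_measure_space X d mu" and doubling: "metric_measure_space.doubling_measure X d mu Cmu"
      and hyps: "openin (Metric_space.mtopology X d) \<Omega>" "metric_measure_space.subminimizer X d mu s \<Omega> u"
      "metric_measure_space.doubling_dimension X d mu c Q" "x\<^sub>0 \<in> \<Omega>"
      "0 < r" "r < R" "Metric_space.mball X d x\<^sub>0 R \<subseteq> \<Omega>"
    for X :: "'a set" and d mu Q \<Omega> u k\<^sub>0 x\<^sub>0 r R
  proof -
    interpret metric_measure_space X d mu by fact
    interpret doubling_space X d mu Cmu
      using doubling by unfold_locales
    show ?thesis
      using hyps assms m by (intro subminimizer_ess_sup_le[of \<Omega>]) (simp_all add: K_def)
  qed
  \<comment> \<open>This is the constant \<open>C\<close>. It involves \<open>s\<close> and
    \<open>Cmu\<close>, partly through \<open>m\<close>, and the constant \<open>c\<close> of the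
    doubling dimension, but neither the space nor \<open>Q\<close>.\<close>
  moreover have "0 < 4 * Cmu ^ (m + 4) / c" using True by simp
  ultimately show ?thesis by blast
next
  \<comment> \<open>A nonpositive \<open>Cmu\<close> or \<open>c\<close> contradicts the definition
    of a doubling measure or of a doubling dimension, so any positive \<open>C\<close>
    serves.\<close>
  case False
  have "\<not> (metric_measure_space.doubling_measure X d mu Cmu \<and> metric_measure_space.doubling_dimension X d mu c Q)"
    if "metric_measure_space X d mu" for X :: "'a set" and d mu Q
    using False that
    by (auto simp: metric_measure_space.doubling_measure_def metric_measure_space.doubling_dimension_def)
  then show ?thesis by (intro exI[of _ 1] conjI zero_less_one) blast
qed

end
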